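(* Let $C_1,C_2$ be real symmetric $3\times3$ matrices satisfying the standing assumptions (given in the context), let $\lambda_1>\lambda_2>\lambda_3>0$ be the eigenvalues of $C_1^{-1}C_2$, and let $e=\sqrt{\frac{\lambda_1-\lambda_2}{\lambda_1-\lambda_3}}$ be the pencil eccentricity. Let $\ell\in(0,\tfrac12)$ and let $\boldsymbol\nu=(\nu_1,\nu_2)$ lie in the cone $\nu_2>0$, $\nu_1+\lambda_3\nu_2>0$. Then the Poncelet map $P_{\boldsymbol\nu}:\mathcal C_1\to\mathcal C_1$ has rotation number $\rho(\boldsymbol\nu)=\ell$ if and only if $(\nu_1,\nu_2)$ lies on the ray in this cone given by $$\frac{\nu_1}{\nu_2}=\frac{\lambda_1\,\mathrm{cn}^2(2K(e)\ell,e)-\lambda_3}{\mathrm{sn}^2(2K(e)\ell,e)}.$$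
   Context: A real symmetric $3\times3$ matrix $C$ defines the conic $\mathcal C=\{(x,y)\in\mathbb R^2:\mathbf u^TC\mathbf u=0,\ \mathbf u=(x,y,1)^T\}$. Standing assumptions on $(C_1,C_2)$: (i) for $i=1,2$ the upper-left $2\times2$ block of $C_i$ is positive definite and $\det C_i<0$; (ii) $C_1^{-1}C_2$ has three positive, distinct eigenvalues; (iii) whenever $\mathbf u\in\mathbb R^3$, $\mathbf u\ne0$ and $\mathbf u^TC_2\mathbf u=0$, then $\mathbf u^TC_1\mathbf u<0$ (the ellipse $\mathcal C_2$ is inside the ellipse $\mathcal C_1$). For $\boldsymbol\nu=(\nu_1,\nu_2)$ let $C_{\boldsymbol\nu}=\nu_1C_1+\nu_2C_2$, with conic $\mathcal C_{\boldsymbol\nu}$. If $\nu_2>0$ and $\nu_1+\lambda_3\nu_2>0$, then $\mathcal C_{\boldsymbol\nu}$ is an ellipse inside $\mathcal C_1$. Poncelet map: for such $\boldsymbol\nu$ and $z_0\in\mathcal C_1$, $P_{\boldsymbol\nu}(z_0)=z_1$ is the unique point of $\mathcal C_1$ such that the segment from $z_0$ to $z_1$ is tangent to $\mathcal C_{\boldsymbol\nu}$ with $\mathcal C_{\boldsymbol\nu}$ on the left when moving from $z_0$ to $z_1$. Elliptic functions: $F(\phi,e)=\int_0^\phi\frac{d\tau}{\sqrt{1-e^2\sin^2\tau}}$, $K(e)=F(\pi/2,e)$; $\mathrm{am}(\cdot,e)$ is the inverse function of $F(\cdot,e)$, $\mathrm{sn}(u,e)=\sin\mathrm{am}(u,e)$,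 $\mathrm{cn}(u,e)=\cos\mathrm{am}(u,e)$ (modulus $e$). Rotation number: $\mathcal C_1$ is oriented counterclockwise and identified with $\mathbb R/\mathbb Z$ by an orientation-preserving homeomorphism; the rotation number of an orientation-preserving circle homeomorphism with lift $G:\mathbb R\to\mathbb R$ is $\lim_{n\to\infty}(G^n(x)-x)/n$ modulo $1$, with the representative taken in $[0,1)$. *)

theory Defs
  imports "HOL-Analysis.Analysis"
begin

definition homog :: "real \<times> real \<Rightarrow> real ^ 3" where
  "homog p = vector [fst p, snd p, 1]"

definition conic_of :: "real ^ 3 ^ 3 \<Rightarrow> (real \<times> real) set" where
  "conic_of C = {p. homog p \<bullet> (C *v homog p) = 0}"

definition upper_left_block :: "real ^ 3 ^ 3 \<Rightarrow> real ^ 2 ^ 2" where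
  "upper_left_block C = vector [vector [C $ 1 $ 1, C $ 1 $ 2], vector [C $ 2 $ 1, C $ 2 $ 2]]"

text \<open>Symmetry is not part of this notion and has to be assumed separately.\<close>
definition positive_definite :: "real ^ 'n ^ 'n \<Rightarrow> bool" where
  "positive_definite A \<longleftrightarrow> (\<forall>v. v \<noteq> 0 \<longrightarrow> v \<bullet> (A *v v) > 0)"

text \<open>Real eigenvalues only.\<close>
definition eigenvalues :: "real ^ 'n ^ 'n \<Rightarrow> real set" where
  "eigenvalues A = {\<mu>. \<exists>v. v \<noteq> 0 \<and> A *v v = \<mu> *\<^sub>R v}"

text \<open>Tangent line of a (symmetric) conic at one of its points: half the gradient of the
  homogeneous quadratic form at that point is \<open>C *v homog p\<close>.\<close>
definition tangent_line :: "real ^ 3 ^ 3 \<Rightarrow> real \<times> real \<Rightarrow> (real \<times> real) set" where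
  "tangent_line C p = {q. homog q \<bullet> (C *v homog p) = 0}"

definition segment_tangent :: "real ^ 3 ^ 3 \<Rightarrow> real \<times> real \<Rightarrow> real \<times> real \<Rightarrow> bool" where
  "segment_tangent C a b \<longleftrightarrow> a \<noteq> b \<and>
     (\<exists>p \<in> conic_of C \<inter> closed_segment a b. closed_segment a b \<subseteq> tangent_line C p)"

text \<open>Twice the signed area of the triangle \<open>a b c\<close>; it is positive iff \<open>c\<close> lies strictly to the
  left of the line directed from \<open>a\<close> to \<open>b\<close>, i.e. iff \<open>a b c\<close> is a counterclockwise triangle.\<close>
definition orient2 :: "real \<times> real \<Rightarrow> real \<times> real \<Rightarrow> real \<times> real \<Rightarrow> real" where
  "orient2 a b c =
     (fst b - fst a) * (snd c - snd a) - (snd b - snd a) * (fst c - fst a)"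

text \<open>The inequality is weak because the point of tangency lies on the line itself.\<close>
definition on_left :: "(real \<times> real) set \<Rightarrow> real \<times> real \<Rightarrow> real \<times> real \<Rightarrow> bool" where
  "on_left S a b \<longleftrightarrow> (\<forall>q \<in> S. orient2 a b q \<ge> 0)"

definition poncelet_map ::
    "real ^ 3 ^ 3 \<Rightarrow> real ^ 3 ^ 3 \<Rightarrow> real \<times> real \<Rightarrow> real \<times> real" where
  "poncelet_map C D z0 =
     (THE z1. z1 \<in> conic_of C \<and> segment_tangent D z0 z1 \<and> on_left (conic_of D) z0 z1)"

text \<open>An identification of \<open>\<real>/\<int>\<close> with a closed curve \<open>S\<close>, given as a 1-periodic map on \<open>\<real>\<close>
  (\<open>\<real>/\<int>\<close> is compact, so the induced continuous bijection is a homeomorphism). Counterclockwise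
  orientation is expressed through triples of points in cyclic order, which is meaningful for
  strictly convex curves such as ellipses, the only ones it is used for.\<close>
definition ccw_identification ::
    "(real \<times> real) set \<Rightarrow> (real \<Rightarrow> real \<times> real) \<Rightarrow> bool" where
  "ccw_identification S h \<longleftrightarrow>
     continuous_on UNIV h \<and> range h = S \<and>
     (\<forall>s t. h s = h t \<longleftrightarrow> s - t \<in> \<int>) \<and>
     (\<forall>r s t. r < s \<and> s < t \<and> t < r + 1 \<longrightarrow> orient2 (h r) (h s) (h t) > 0)"

text \<open>Lifts of orientation-preserving circle homeomorphisms.\<close>
definition circle_lift ::
    "(real \<Rightarrow> 'a) \<Rightarrow> ('a \<Rightarrow> 'a) \<Rightarrow> (real \<Rightarrow> real) \<Rightarrow> bool" where
  "circle_lift h f G \<longleftrightarrow>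
     continuous_on UNIV G \<and> strict_mono G \<and> (\<forall>x. G (x + 1) = G x + 1) \<and>
     (\<forall>x. h (G x) = f (h x))"

definition has_rotation_number ::
    "(real \<times> real) set \<Rightarrow> (real \<times> real \<Rightarrow> real \<times> real) \<Rightarrow> real \<Rightarrow> bool" where
  "has_rotation_number S f \<rho> \<longleftrightarrow>
     (\<exists>h G L. ccw_identification S h \<and> circle_lift h f G \<and>
        (\<forall>x. (\<lambda>n. ((G ^^ n) x - x) / real n) \<longlonglongrightarrow> L) \<and> \<rho> = frac L)"

definition rotation_number ::
    "(real \<times> real) set \<Rightarrow> (real \<times> real \<Rightarrow> real \<times> real) \<Rightarrow> real" where
  "rotation_number S f = (THE \<rho>. has_rotation_number S f \<rho>)"

text \<open>The second argument is the modulus. The interval integral is oriented, so \<open>ellF\<close> is odd in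
  its first argument.\<close>
definition ellF :: "real \<Rightarrow> real \<Rightarrow> real" where
  "ellF \<phi> e = (LBINT \<tau>=0..\<phi>. 1 / sqrt (1 - e\<^sup>2 * (sin \<tau>)\<^sup>2))"

definition ellK :: "real \<Rightarrow> real" where
  "ellK e = ellF (pi / 2) e"

definition am :: "real \<Rightarrow> real \<Rightarrow> real" where
  "am u e = inv (\<lambda>\<phi>. ellF \<phi> e) u"

definition sn :: "real \<Rightarrow> real \<Rightarrow> real" where
  "sn u e = sin (am u e)"

definition cn :: "real \<Rightarrow> real \<Rightarrow> real" where
  "cn u e = cos (am u e)"

end

theory Submission
  imports Defs
begin

text \<open>
  A frame of generalised eigenvectors of the pencil turns \<open>C1\<close> into \<open>x\<^sup>2 + y\<^sup>2 - z\<^sup>2\<close>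
  and \<open>\<nu>1 C1 + \<nu>2 C2\<close> into \<open>\<alpha> x\<^sup>2 + \<beta> y\<^sup>2 - \<gamma> z\<^sup>2\<close> with
  \<open>\<alpha> = \<nu>1 + \<lambda>1 \<nu>2\<close>, \<open>\<beta> = \<nu>1 + \<lambda>2 \<nu>2\<close>, \<open>\<gamma> = \<nu>1 + \<lambda>3 \<nu>2\<close>
  (\<open>simultaneous_diagonalization\<close>). The outer conic becomes the unit circle, parametrised by an
  angle, and the inner one an ellipse \<open>\<alpha> x\<^sup>2 + \<beta> y\<^sup>2 = \<gamma>\<close> inside it. The change of
  coordinates is projective; it preserves orientation and segments because the third coordinate stays
  positive on the closed disc.

  The chord of the circle with end points \<open>s - d\<close> and \<open>s + d\<close> has equation
  \<open>x cos s + y sin s = cos d\<close>; it is tangent to the ellipse exactly if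
  \<open>cos\<^sup>2 d = (\<gamma>/\<alpha>) cos\<^sup>2 s + (\<gamma>/\<beta>) sin\<^sup>2 s\<close>. This determines the
  half angle \<open>d\<close> as a function of \<open>s\<close>, and the Poncelet map sends the angle
  \<open>s - d s\<close> to \<open>s + d s\<close> (\<open>poncelet_map_pt\<close>). The key fact is that
  \<open>F (s + d s) - F (s - d s)\<close> does not depend on \<open>s\<close>, where \<open>F\<close> is the elliptic
  integral of modulus \<open>e\<close> (\<open>ellF_chord_constant\<close>): its derivative vanishes by a polynomial
  identity. The modulus is the same for the whole pencil, since
  \<open>(\<alpha> - \<beta>) / (\<alpha> - \<gamma>) = (\<lambda>1 - \<lambda>2) / (\<lambda>1 - \<lambda>3)\<close>. So in the
  coordinate \<open>t = F \<phi> / (4 K)\<close>, which identifies the outer conic with \<open>\<real>/\<int>\<close>, every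
  Poncelet map of the pencil is a rotation, by the angle \<open>\<rho> = F d / (2 K)\<close> with \<open>d\<close> the
  half angle of the chord with \<open>s = 0\<close>, for which \<open>cos\<^sup>2 d = \<gamma>/\<alpha>\<close>
  (\<open>rotation_number_poncelet_map\<close>). Hence \<open>\<rho>\<close> equals a given \<open>l\<close> if and only if
  \<open>d = am (2 K l)\<close>, that is, \<open>\<gamma>/\<alpha> = cn\<^sup>2 (2 K l)\<close>, and solving this for
  \<open>\<nu>1/\<nu>2\<close> gives the ray.

  The rotation number is defined through an arbitrary identification of the curve with
  \<open>\<real>/\<int>\<close>. That the choice is immaterial follows since two counterclockwise
  identifications differ by a homeomorphism of \<open>\<real>\<close> at bounded distance from the identity
  (\<open>ccw_identification_transition\<close>).
\<close>

section \<open>Rotation numbers of maps conjugate to a translation\<close>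

lemma orient2_swap: "orient2 a c b = - orient2 a b c"
  by (simp add: orient2_def algebra_simps)

lemma ccw_identification_eq_iff:
  assumes "ccw_identification S h"
  shows "h s = h t \<longleftrightarrow> s - t \<in> \<int>"
  using assms by (auto simp: ccw_identification_def)

text \<open>Both parametrisations run through the curve in the same cyclic order. So once the value \<open>\<tau>\<close> at 0 is
chosen, each unit interval \<open>[n, n + 1)\<close> is mapped increasingly onto \<open>[\<tau> + n, \<tau> + n + 1)\<close>;
an increasing surjection of \<open>\<real>\<close> is continuous.\<close>
lemma ccw_identification_transition:
  assumes h: "ccw_identification S h" and k: "ccw_identification S k"
  obtains \<sigma> B where "continuous_on UNIV \<sigma>" "\<And>x. \<bar>\<sigma> x - x\<bar> \<le> B" "\<And>x. k x = h (\<sigma> x)"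
proof -
  have hk: "range h = range k" using h k by (simp add: ccw_identification_def)
  obtain \<tau> where \<tau>: "h \<tau> = k 0" using hk by (metis rangeI rangeE)
  \<comment> \<open>Prescribing the integer part selects one of the preimages, which differ by integers.\<close>
  have "\<exists>t. h t = k x \<and> \<lfloor>t - \<tau>\<rfloor> = \<lfloor>x\<rfloor>" for x
  proof -
    obtain t where t: "h t = k x" using hk by (metis rangeI rangeE)
    have "h (t + of_int (\<lfloor>x\<rfloor> - \<lfloor>t - \<tau>\<rfloor>)) = h t"
      by (subst ccw_identification_eq_iff[OF h]) (simp flip: of_int_diff)
    moreover have "\<lfloor>t + of_int (\<lfloor>x\<rfloor> - \<lfloor>t - \<tau>\<rfloor>) - \<tau>\<rfloor> = \<lfloor>x\<rfloor>"
      by linarith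
    ultimately show ?thesis using t by metis
  qed
  then obtain \<sigma> where \<sigma>: "\<And>x. h (\<sigma> x) = k x" and fl: "\<And>x. \<lfloor>\<sigma> x - \<tau>\<rfloor> = \<lfloor>x\<rfloor>"
    by metis
  have uniq: "\<sigma> x = t" if "h t = k x" "\<lfloor>t - \<tau>\<rfloor> = \<lfloor>x\<rfloor>" for x t
  proof -
    have "\<sigma> x - t \<in> \<int>" using that \<sigma> ccw_identification_eq_iff[OF h] by metis
    then obtain n where n: "\<sigma> x - t = of_int n" by (auto elim: Ints_cases)
    have "n = 0" using n fl[of x] that(2) by linarith
    then show ?thesis using n by simp
  qed
  have surj: "range \<sigma> = UNIV"
  proof -
    have "\<exists>x. \<sigma> x = t" for t
    proof -
      obtain x where x: "k x = h t" using hk by (metis rangeI rangeE)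
      have "k (x + of_int (\<lfloor>t - \<tau>\<rfloor> - \<lfloor>x\<rfloor>)) = k x"
        by (subst ccw_identification_eq_iff[OF k]) (simp flip: of_int_diff)
      then have "\<sigma> (x + of_int (\<lfloor>t - \<tau>\<rfloor> - \<lfloor>x\<rfloor>)) = t"
        by (intro uniq) (use x in auto)
      then show ?thesis ..
    qed
    then show ?thesis by (metis surj_def)
  qed
  have mono: "\<sigma> x < \<sigma> y" if xy: "x < y" for x y
  proof (cases "\<lfloor>x\<rfloor> = \<lfloor>y\<rfloor>")
    case False
    then show ?thesis using fl[of x] fl[of y] xy by linarith
  next
    case True
    define n :: real where "n = of_int \<lfloor>x\<rfloor>"
    have n: "n \<le> x" "y < n + 1" using True by (auto simp: n_def) linarith
    have "k n = k 0" by (subst ccw_identification_eq_iff[OF k]) (simp add: n_def)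
    moreover have "h (\<tau> + n) = h \<tau>"
      by (subst ccw_identification_eq_iff[OF h]) (simp add: n_def)
    ultimately have sn: "\<sigma> n = \<tau> + n"
      using \<tau> by (intro uniq) (auto simp: n_def)
    have inj: "\<sigma> u \<noteq> \<sigma> v" if "u < v" "v < u + 1" for u v
    proof
      assume "\<sigma> u = \<sigma> v"
      then have "v - u \<in> \<int>" using \<sigma> ccw_identification_eq_iff[OF k] by metis
      then obtain z where z: "v - u = of_int z" by (auto elim: Ints_cases)
      have "0 < z" "z < 1" using z that by linarith+
      then show False by simp
    qed
    have bnd: "\<tau> + n \<le> \<sigma> z" "\<sigma> z < \<tau> + n + 1" if "z = x \<or> z = y" for z
    proof -
      have "\<lfloor>\<sigma> z - \<tau>\<rfloor> = \<lfloor>x\<rfloor>" using that fl[of z] True by auto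
      then show "\<tau> + n \<le> \<sigma> z" "\<sigma> z < \<tau> + n + 1" unfolding n_def by linarith+
    qed
    show ?thesis
    proof (cases "x = n")
      case True
      then show ?thesis using inj[of x y] sn bnd[of y] xy n by auto
    next
      case False
      \<comment> \<open>With the base point \<open>k n\<close>, an inversion by \<open>\<sigma>\<close> would give this triple both orientations.\<close>
      then have "orient2 (k n) (k x) (k y) > 0"
        using k n xy unfolding ccw_identification_def by force
      then have pos: "orient2 (h (\<sigma> n)) (h (\<sigma> x)) (h (\<sigma> y)) > 0" using \<sigma> by simp
      show ?thesis
      proof (rule ccontr)
        assume "\<not> \<sigma> x < \<sigma> y"
        then have lt: "\<sigma> y < \<sigma> x" using inj[of x y] xy n by auto
        have "\<sigma> n < \<sigma> y" using inj[of n y] sn bnd[of y] xy n by auto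
        moreover have "\<sigma> x < \<sigma> n + 1" using sn bnd[of x] by auto
        ultimately have "orient2 (h (\<sigma> n)) (h (\<sigma> y)) (h (\<sigma> x)) > 0"
          using h lt unfolding ccw_identification_def by blast
        then show False using pos orient2_swap[of "h (\<sigma> n)" "h (\<sigma> x)" "h (\<sigma> y)"] by linarith
      qed
    qed
  qed
  have cont: "continuous_on UNIV \<sigma>"
    by (rule continuous_onI_mono) (use surj mono in \<open>auto simp: less_eq_real_def\<close>)
  have "\<bar>\<sigma> x - x\<bar> \<le> \<bar>\<tau>\<bar> + 1" for x using fl[of x] by linarith
  then show thesis using that cont \<sigma> by metis
qed

lemma continuous_Ints_constant:
  fixes g :: "real \<Rightarrow> real"
  assumes "continuous_on UNIV g" "\<And>x. g x \<in> \<int>"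
  shows "g x = g y"
proof -
  have "g constant_on UNIV"
  proof (rule continuous_discrete_range_constant[OF connected_UNIV assms(1)])
    fix x
    have "1 \<le> norm (g y - g x)" if "g y \<noteq> g x" for y
      using that assms(2)[of x] assms(2)[of y] by (auto elim!: Ints_cases)
    then show "\<exists>e>0. \<forall>y. y \<in> UNIV \<and> g y \<noteq> g x \<longrightarrow> e \<le> norm (g y - g x)"
      by (intro exI[of _ 1]) auto
  qed
  then show ?thesis unfolding constant_on_def by auto
qed

text \<open>A lift \<open>G\<close> with respect to any other identification becomes, after the transition map
\<open>\<sigma>\<close>, the translation by \<open>\<rho>\<close> up to an integer; by continuity it is the same integer
\<open>m\<close> everywhere. Since \<open>\<sigma>\<close> moves points by a bounded amount, the mean displacement of
\<open>G\<close> is \<open>\<rho> + m\<close>. This shows that the definite description in the definition of the rotation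
number has a unique solution.\<close>
lemma rotation_number_eq_if_conjugate_to_translation:
  assumes h: "ccw_identification S h" and f: "\<And>x. f (h x) = h (x + \<rho>)" and \<rho>: "0 \<le> \<rho>" "\<rho> < 1"
  shows "rotation_number S f = \<rho>"
  unfolding rotation_number_def
proof (rule the_equality)
  have it: "((\<lambda>x. x + \<rho>) ^^ n) x = x + n * \<rho>" for n x
    by (induction n) (auto simp: algebra_simps)
  have "(\<lambda>n. (((\<lambda>x. x + \<rho>) ^^ n) x - x) / real n) \<longlonglongrightarrow> \<rho>" for x
    by (intro tendsto_eventually eventually_mono[OF eventually_gt_at_top[of 0]]) (simp add: it)
  moreover have "circle_lift h f (\<lambda>x. x + \<rho>)"
    by (auto simp: circle_lift_def f strict_mono_def intro!: continuous_intros)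
  moreover have "\<rho> = frac \<rho>" using \<rho> by (simp add: frac_eq)
  ultimately show "has_rotation_number S f \<rho>"
    unfolding has_rotation_number_def using h by blast
next
  fix r assume "has_rotation_number S f r"
  then obtain k G L where k: "ccw_identification S k" and G: "circle_lift k f G"
    and lim: "\<And>x. (\<lambda>n. ((G ^^ n) x - x) / real n) \<longlonglongrightarrow> L" and r: "r = frac L"
    unfolding has_rotation_number_def by blast
  obtain \<sigma> B where cont: "continuous_on UNIV \<sigma>" and B: "\<And>x. \<bar>\<sigma> x - x\<bar> \<le> B"
    and \<sigma>: "\<And>x. k x = h (\<sigma> x)"
    using ccw_identification_transition[OF h k] by metis
  define g where "g x = \<sigma> (G x) - (\<sigma> x + \<rho>)" for x
  have "h (\<sigma> (G x)) = h (\<sigma> x + \<rho>)" for x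
    using G \<sigma> f by (metis circle_lift_def)
  then have "g x \<in> \<int>" for x
    using ccw_identification_eq_iff[OF h] by (simp add: g_def)
  moreover have "continuous_on UNIV g"
    unfolding g_def using G cont
    by (auto simp: circle_lift_def intro!: continuous_intros continuous_on_compose2[OF cont])
  ultimately have gc: "g x = g 0" for x using continuous_Ints_constant by blast
  obtain m where m: "g 0 = of_int m" using \<open>g 0 \<in> \<int>\<close> by (auto elim: Ints_cases)
  have step: "\<sigma> (G x) = \<sigma> x + (\<rho> + of_int m)" for x
    using gc[of x] m by (simp add: g_def)
  have it: "\<sigma> ((G ^^ n) 0) = \<sigma> 0 + n * (\<rho> + of_int m)" for n
    by (induction n) (auto simp: step algebra_simps)
  have "(\<lambda>n. ((G ^^ n) 0 - 0) / real n - (\<rho> + of_int m)) \<longlonglongrightarrow> 0"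
  proof (rule Lim_null_comparison)
    show "\<forall>\<^sub>F n in sequentially. norm (((G ^^ n) 0 - 0) / real n - (\<rho> + of_int m)) \<le> 2 * B / real n"
    proof (intro eventually_mono[OF eventually_gt_at_top[of 0]])
      fix n :: nat assume n: "n > 0"
      have "\<bar>(G ^^ n) 0 - n * (\<rho> + of_int m)\<bar> \<le> 2 * B"
        using B[of "(G ^^ n) 0"] B[of 0] unfolding it by linarith
      moreover have "((G ^^ n) 0 - 0) / real n - (\<rho> + of_int m)
          = ((G ^^ n) 0 - n * (\<rho> + of_int m)) / n"
        using n by (simp add: field_simps)
      ultimately show "norm (((G ^^ n) 0 - 0) / real n - (\<rho> + of_int m)) \<le> 2 * B / real n"
        using n by (simp add: divide_right_mono)
    qed
    show "(\<lambda>n. 2 * B / real n) \<longlonglongrightarrow> 0" by (rule lim_const_over_n)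
  qed
  then have "(\<lambda>n. ((G ^^ n) 0 - 0) / real n) \<longlonglongrightarrow> \<rho> + of_int m"
    by (rule LIM_zero_cancel)
  then have "L = \<rho> + of_int m" using lim[of 0] by (rule LIMSEQ_unique[rotated])
  then show "r = \<rho>" using r \<rho> by (simp add: frac_add_of_int_right frac_eq)
qed

section \<open>The elliptic integral of the first kind and the amplitude\<close>

lemma elliptic_radicand_pos:
  fixes e :: real assumes "e\<^sup>2 < 1" shows "0 < 1 - e\<^sup>2 * (sin x)\<^sup>2"
proof -
  have "e\<^sup>2 * (sin x)\<^sup>2 \<le> e\<^sup>2 * 1"
    by (intro mult_left_mono) (auto simp: abs_square_le_1)
  then show ?thesis using assms by linarith
qed

lemma ellF_has_derivative:
  assumes e: "e\<^sup>2 < 1"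
  shows "((\<lambda>\<phi>. ellF \<phi> e) has_real_derivative 1 / sqrt (1 - e\<^sup>2 * (sin x)\<^sup>2)) (at x)"
proof -
  define a b where "a = - \<bar>x\<bar> - 1" and "b = \<bar>x\<bar> + 1"
  have "((\<lambda>\<phi>. ellF \<phi> e) has_vector_derivative 1 / sqrt (1 - e\<^sup>2 * (sin x)\<^sup>2)) (at x within {a..b})"
    unfolding ellF_def zero_ereal_def
    by (rule interval_integral_FTC2)
       (use elliptic_radicand_pos[OF e] in
         \<open>auto simp: a_def b_def less_imp_neq[symmetric] intro!: continuous_intros\<close>)
  moreover have "at x within {a..b} = at x"
    by (rule at_within_interior) (auto simp: a_def b_def)
  ultimately show ?thesis by (simp add: has_real_derivative_iff_has_vector_derivative)
qed

lemma ellF_0: "ellF 0 e = 0"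
  by (simp add: ellF_def zero_ereal_def)

context
  fixes e :: real assumes e: "e\<^sup>2 < 1"
begin

lemmas ellF_deriv [derivative_intros] = DERIV_chain2[OF ellF_has_derivative[OF e]]

lemma ellF_strict_mono: "strict_mono (\<lambda>\<phi>. ellF \<phi> e)"
  by (rule strict_monoI, rule DERIV_pos_imp_increasing)
     (use ellF_has_derivative[OF e] elliptic_radicand_pos[OF e] in force)+

lemma ellF_minus: "ellF (- x) e = - ellF x e"
proof -
  have "((\<lambda>x. ellF (- x) e + ellF x e) has_real_derivative 0) (at x)" for x
    by (auto intro!: derivative_eq_intros)
  then have "ellF (- x) e + ellF x e = ellF (- 0) e + ellF 0 e"
    using DERIV_isconst_all by blast
  then show ?thesis by (simp add: ellF_0)
qed

text \<open>The integrand has period \<open>\<pi>\<close> and is even, so the increment over any interval of length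
\<open>\<pi>\<close> is the one over \<open>[-\<pi>/2, \<pi>/2]\<close>.\<close>
lemma ellF_add_pi: "ellF (x + pi) e = ellF x e + 2 * ellK e"
proof -
  have "((\<lambda>x. ellF (x + pi) e - ellF x e) has_real_derivative 0) (at x)" for x
    by (auto intro!: derivative_eq_intros)
  then have "ellF (x + pi) e - ellF x e = ellF (- (pi / 2) + pi) e - ellF (- (pi / 2)) e"
    using DERIV_isconst_all by blast
  then show ?thesis by (simp add: ellF_minus ellK_def)
qed

lemma ellF_add_2pi_int: "ellF (x + 2 * pi * of_int n) e = ellF x e + 4 * ellK e * of_int n"
proof -
  have *: "ellF (x + 2 * pi * real n) e = ellF x e + 4 * ellK e * real n" for n x
  proof (induction n)
    case (Suc n)
    have "x + 2 * pi * real (Suc n) = (x + 2 * pi * real n) + pi + pi" by (simp add: algebra_simps)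
    then show ?case by (simp only: ellF_add_pi Suc) (simp add: algebra_simps)
  qed simp
  show ?thesis
  proof (cases "n \<ge> 0")
    case True
    then show ?thesis using *[of x "nat n"] by simp
  next
    case False
    then show ?thesis using *[of "x + 2 * pi * of_int n" "nat (- n)"] by simp
  qed
qed

lemma ellK_pos: "0 < ellK e"
  using strict_monoD[OF ellF_strict_mono, of 0 "pi / 2"] by (simp add: ellF_0 ellK_def)

lemma ellF_bij: "bij (\<lambda>\<phi>. ellF \<phi> e)"
proof -
  have "\<exists>x. ellF x e = u" for u
  proof -
    obtain n :: nat where n: "\<bar>u\<bar> < n * (4 * ellK e)" 
      using ellK_pos ex_less_of_nat_mult[of "4 * ellK e" "\<bar>u\<bar>"] by auto
    have "ellF (- (2 * pi * of_int (int n))) e \<le> u" "u \<le> ellF (2 * pi * of_int (int n)) e"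
      unfolding ellF_minus using ellF_add_2pi_int[of 0 "int n"] n by (auto simp: ellF_0 algebra_simps)
    then show ?thesis
      using IVT[of "\<lambda>\<phi>. ellF \<phi> e" "- (2 * pi * of_int (int n))" u "2 * pi * of_int (int n)"]
        DERIV_isCont[OF ellF_has_derivative[OF e]] by fastforce
  qed
  then show ?thesis using strict_mono_imp_inj_on[OF ellF_strict_mono]
    by (metis bij_def surj_def)
qed

lemma am_ellF: "am (ellF x e) e = x"
  unfolding am_def using inv_f_f[OF bij_is_inj[OF ellF_bij]] .

lemma ellF_am: "ellF (am u e) e = u"
  unfolding am_def using surj_f_inv_f[OF bij_is_surj[OF ellF_bij]] .

lemma am_less_iff: "am u e < am v e \<longleftrightarrow> u < v"
  by (metis ellF_am strict_mono_less[OF ellF_strict_mono])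

lemma am_add: "am (u + 4 * ellK e * of_int n) e = am u e + 2 * pi * of_int n"
  by (metis am_ellF ellF_am ellF_add_2pi_int)

lemma continuous_on_am: "continuous_on UNIV (\<lambda>u. am u e)"
proof (rule continuous_onI_mono)
  have "range (\<lambda>u. am u e) = UNIV" by (metis am_ellF surj_def)
  then show "open (range (\<lambda>u. am u e))" by simp
qed (metis am_less_iff not_le)

end

section \<open>The invariant measure along tangent chords\<close>

text \<open>Here \<open>A\<close> and \<open>B\<close> are the squares of the semi-axes of an ellipse
\<open>x\<^sup>2/A + y\<^sup>2/B = 1\<close> inside the unit circle. The condition on \<open>e\<close> says that
\<open>e\<close> is the eccentricity of the pencil that the circle and the ellipse span.\<close>
locale half_chord =
  fixes A B e :: real
  assumes A: "0 < A" and AB: "A < B" and B: "B < 1" and eAB: "e\<^sup>2 * (B * (1 - A)) = B - A"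
begin

text \<open>Half the arc that is cut off by the chord of the unit circle which is tangent to the ellipse and has
normal direction \<open>s\<close>: its distance from the centre is the value of the support function.\<close>
definition half_angle :: "real \<Rightarrow> real" where
  "half_angle s = arccos (sqrt (A * (cos s)\<^sup>2 + B * (sin s)\<^sup>2))"

lemma modulus: "e\<^sup>2 < 1"
proof -
  have "B - A < B * (1 - A)" using A B by (simp add: algebra_simps)
  then have "e\<^sup>2 * (B * (1 - A)) < 1 * (B * (1 - A))" using eAB by simp
  then show ?thesis by (rule mult_right_less_imp_less) (use A AB B in auto)
qed

lemma half_angle:
  shows cos_half_angle: "(cos (half_angle s))\<^sup>2 = A * (cos s)\<^sup>2 + B * (sin s)\<^sup>2"
    and half_angle_pos: "0 < half_angle s" and half_angle_less: "half_angle s < pi / 2"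
    and radicand_pos: "0 < A * (cos s)\<^sup>2 + B * (sin s)\<^sup>2"
    and radicand_less: "A * (cos s)\<^sup>2 + B * (sin s)\<^sup>2 < 1"
proof -
  define q where "q = A * (cos s)\<^sup>2 + B * (sin s)\<^sup>2"
  have q: "q = A + (B - A) * (sin s)\<^sup>2" by (simp add: q_def cos_squared_eq algebra_simps)
  have "0 \<le> (B - A) * (sin s)\<^sup>2" using AB by simp
  then have q0: "0 < q" using q A by simp
  have "(B - A) * (sin s)\<^sup>2 \<le> (B - A) * 1"
    using AB by (intro mult_left_mono) (auto simp: abs_square_le_1)
  then have q1: "q < 1" using q B by simp
  show "0 < A * (cos s)\<^sup>2 + B * (sin s)\<^sup>2" "A * (cos s)\<^sup>2 + B * (sin s)\<^sup>2 < 1"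
    using q0 q1 by (simp_all add: q_def)
  have sq: "0 < sqrt q" "sqrt q < 1" using q0 q1 by auto
  have "cos (arccos (sqrt q)) = sqrt q" by (rule cos_arccos) (use sq in linarith)+
  then show "(cos (half_angle s))\<^sup>2 = A * (cos s)\<^sup>2 + B * (sin s)\<^sup>2"
    using q0 unfolding half_angle_def q_def[symmetric] by simp
  show "0 < half_angle s" "half_angle s < pi / 2"
    using arccos_lt_bounded[of "sqrt q"] sq arccos_less_arccos[of 0 "sqrt q"]
    unfolding half_angle_def q_def[symmetric] by simp_all
qed

lemma half_angle_derivative:
  "(half_angle has_real_derivative
     - ((B - A) * (sin s * cos s)) / (sin (half_angle s) * cos (half_angle s))) (at s)"
proof -
  define q where "q = A * (cos s)\<^sup>2 + B * (sin s)\<^sup>2"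
  have q: "0 < q" "q < 1" unfolding q_def using radicand_pos radicand_less by auto
  have sq: "0 < sqrt q" "sqrt q < 1" using q by auto
  have h: "half_angle s = arccos (sqrt q)" by (simp add: half_angle_def q_def)
  have c: "cos (half_angle s) = sqrt q" unfolding h by (rule cos_arccos) (use sq in linarith)+
  have si: "sin (half_angle s) = sqrt (1 - q)"
  proof -
    have "sin (arccos (sqrt q)) = sqrt (1 - (sqrt q)\<^sup>2)"
      by (rule sin_arccos) (use sq in linarith)+
    then show ?thesis unfolding h using q by simp
  qed
  have "- 1 < sqrt q" using sq by linarith
  have "((\<lambda>s. arccos (sqrt (A * (cos s)\<^sup>2 + B * (sin s)\<^sup>2))) has_real_derivative
     - ((B - A) * (sin s * cos s)) / (sqrt (1 - q) * sqrt q)) (at s)"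
    using q \<open>- 1 < sqrt q\<close>
    by (auto intro!: derivative_eq_intros simp: q_def[symmetric] simp del: real_sqrt_gt_0_iff)
       (simp add: divide_inverse algebra_simps)
  then show ?thesis unfolding si c by (simp only: half_angle_def[abs_def])
qed

text \<open>The difference of the two sides is the convex combination
\<open>B (1 - B) sin\<^sup>2 s + A (1 - A) cos\<^sup>2 s\<close>. The inequality says that the derivative of the half
angle has absolute value less than 1, so that both end points of the chord advance with \<open>s\<close>; it
also says that the point of tangency lies strictly between them.\<close>
lemma half_angle_slope:
  "((B - A) * (sin s * cos s))\<^sup>2 < (sin (half_angle s) * cos (half_angle s))\<^sup>2"
proof -
  define c2 where "c2 = (cos s)\<^sup>2"
  have s2: "(sin s)\<^sup>2 = 1 - c2" by (simp add: c2_def sin_squared_eq)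
  have d2: "(cos (half_angle s))\<^sup>2 = A * c2 + B * (1 - c2)"
    using cos_half_angle[of s] by (simp add: c2_def s2)
  have c2: "0 \<le> c2" "c2 \<le> 1" by (auto simp: c2_def abs_square_le_1)
  have "(sin (half_angle s) * cos (half_angle s))\<^sup>2 - ((B - A) * (sin s * cos s))\<^sup>2
      = (1 - c2) * (B * (1 - B)) + c2 * (A * (1 - A))"
    unfolding power_mult_distrib sin_squared_eq[of "half_angle s"] d2 s2 c2_def[symmetric]
    by algebra
  moreover have "\<dots> > 0"
    using A AB B c2 by (cases "c2 = 0") (auto intro!: add_nonneg_pos mult_pos_pos mult_nonneg_nonneg)
  ultimately show ?thesis by simp
qed

lemma half_angle_between:
  "\<bar>(B - A) * (sin s * cos s)\<bar> < sin (half_angle s) * cos (half_angle s)"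
proof (rule power_less_imp_less_base)
  show "\<bar>(B - A) * (sin s * cos s)\<bar> ^ 2 < (sin (half_angle s) * cos (half_angle s))\<^sup>2"
    using half_angle_slope by simp
  have "0 < sin (half_angle s)" "0 < cos (half_angle s)"
    using half_angle_pos[of s] half_angle_less[of s] by (auto intro: sin_gt_zero cos_gt_zero)
  then show "0 \<le> sin (half_angle s) * cos (half_angle s)" by simp
qed

text \<open>With \<open>X = sin s cos s\<close> and \<open>Y = sin d cos d\<close>, the end points \<open>s + d\<close> and
\<open>s - d\<close> move with speeds \<open>1 - (B - A) X / Y\<close> and \<open>1 + (B - A) X / Y\<close>. The identity
says that the squared speeds are proportional to \<open>1 - e\<^sup>2 sin\<^sup>2\<close> at the end points.\<close>
lemma half_angle_identity:
  fixes s defines "d \<equiv> half_angle s"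
  shows "(sin d * cos d - (B - A) * (sin s * cos s))\<^sup>2 * (1 - e\<^sup>2 * (sin (s - d))\<^sup>2)
    = (sin d * cos d + (B - A) * (sin s * cos s))\<^sup>2 * (1 - e\<^sup>2 * (sin (s + d))\<^sup>2)"
proof -
  define X Y P where "X = sin s * cos s" and "Y = sin d * cos d"
    and "P = (sin s)\<^sup>2 * (cos d)\<^sup>2 + (cos s)\<^sup>2 * (sin d)\<^sup>2"
  define c2 where "c2 = (cos s)\<^sup>2"
  have s2: "(sin s)\<^sup>2 = 1 - c2" by (simp add: c2_def sin_squared_eq)
  have d2: "(cos d)\<^sup>2 = A * c2 + B * (1 - c2)"
    using cos_half_angle[of s] by (simp add: c2_def s2 d_def)
  have sd2: "(sin d)\<^sup>2 = 1 - (A * c2 + B * (1 - c2))" by (simp add: sin_squared_eq d2)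
  \<comment> \<open>The only relation used is that between \<open>cos\<^sup>2 d\<close> and \<open>cos\<^sup>2 s\<close>; the left-hand side is quadratic in \<open>cos\<^sup>2 s\<close> and its nonconstant terms cancel.\<close>
  have key: "Y\<^sup>2 + (B - A)\<^sup>2 * X\<^sup>2 + (B - A) * P = B * (1 - A)"
    unfolding X_def Y_def P_def power_mult_distrib sd2 d2 s2 c2_def[symmetric] by algebra
  have p: "(sin (s + d))\<^sup>2 = P + 2 * X * Y" and m: "(sin (s - d))\<^sup>2 = P - 2 * X * Y"
    by (simp_all add: sin_add sin_diff P_def X_def Y_def power2_eq_square algebra_simps)
  have "(Y - (B - A) * X)\<^sup>2 * (1 - e\<^sup>2 * (P - 2 * X * Y))
      - (Y + (B - A) * X)\<^sup>2 * (1 - e\<^sup>2 * (P + 2 * X * Y))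
      = 4 * X * Y * (e\<^sup>2 * (Y\<^sup>2 + (B - A)\<^sup>2 * X\<^sup>2 + (B - A) * P) - (B - A))"
    by (simp add: power2_eq_square algebra_simps)
  also have "\<dots> = 0" unfolding key eAB by simp
  finally show ?thesis unfolding p m X_def[symmetric] Y_def[symmetric] by simp
qed

text \<open>This is Poncelet's theorem in its measure form: every chord tangent to the ellipse cuts off an arc of
the same measure \<open>d\<phi> / sqrt (1 - e\<^sup>2 sin\<^sup>2 \<phi>)\<close>. The measure of the arc has derivative 0
by \<open>half_angle_identity\<close>; the signs of the square roots are fixed by \<open>half_angle_between\<close>.\<close>
lemma ellF_chord_constant:
  "ellF (s + half_angle s) e = ellF (s - half_angle s) e + 2 * ellF (half_angle 0) e"
proof -
  have "((\<lambda>s. ellF (s + half_angle s) e - ellF (s - half_angle s) e) has_real_derivative 0) (at s)"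
    for s
  proof -
    define d where "d = half_angle s"
    define X Y where "X = (B - A) * (sin s * cos s)" and "Y = sin d * cos d"
    define Dp Dm where "Dp = sqrt (1 - e\<^sup>2 * (sin (s + d))\<^sup>2)"
      and "Dm = sqrt (1 - e\<^sup>2 * (sin (s - d))\<^sup>2)"
    have XY: "\<bar>X\<bar> < Y" using half_angle_between[of s] by (simp add: X_def Y_def d_def)
    have D: "0 < Dp" "0 < Dm"
      using elliptic_radicand_pos[OF modulus] by (simp_all add: Dp_def Dm_def)
    have "((Y - X) * Dm)\<^sup>2 = ((Y + X) * Dp)\<^sup>2"
      using half_angle_identity[of s] elliptic_radicand_pos[OF modulus]
      by (simp add: power_mult_distrib Dp_def Dm_def X_def Y_def d_def less_imp_le)
    then have eq: "(Y - X) * Dm = (Y + X) * Dp"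
      using XY D by (subst (asm) power2_eq_iff_nonneg) auto
    have "((\<lambda>s. ellF (s + half_angle s) e - ellF (s - half_angle s) e) has_real_derivative
        1 / Dp * (1 + - X / Y) - 1 / Dm * (1 - - X / Y)) (at s)"
      by (auto intro!: derivative_eq_intros ellF_deriv[OF modulus] half_angle_derivative
          simp: modulus Dp_def Dm_def X_def Y_def d_def)
    moreover have "1 / Dp * (1 + - X / Y) - 1 / Dm * (1 - - X / Y) = 0"
    proof -
      have "1 / Dp * (1 + - X / Y) - 1 / Dm * (1 - - X / Y) = ((Y - X) * Dm - (Y + X) * Dp) / (Dp * Dm * Y)"
      proof -
        have "Y \<noteq> 0" using XY by auto
        then show ?thesis using D by (simp add: field_simps)
      qed
      then show ?thesis using eq by simp
    qed
    ultimately show ?thesis by simp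
  qed
  then have "ellF (s + half_angle s) e - ellF (s - half_angle s) e
      = ellF (0 + half_angle 0) e - ellF (0 - half_angle 0) e"
    using DERIV_isconst_all by blast
  then show ?thesis by (simp add: ellF_minus[OF modulus])
qed

text \<open>By continuity; it allows the Poncelet image of an arbitrary point to be described by a tangent chord.\<close>
lemma half_angle_start:
  obtains s where "\<phi> = s - half_angle s"
proof -
  have "continuous_on UNIV (\<lambda>s. s - half_angle s)"
    using half_angle_derivative DERIV_isCont
    by (intro continuous_intros continuous_at_imp_continuous_on) blast
  then have "\<And>s. isCont (\<lambda>s. s - half_angle s) s" by (simp add: continuous_on_eq_continuous_at)
  moreover have "\<phi> - half_angle \<phi> \<le> \<phi>" "\<phi> \<le> (\<phi> + pi / 2) - half_angle (\<phi> + pi / 2)"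
    using half_angle_pos[of \<phi>] half_angle_less[of "\<phi> + pi / 2"] by auto
  ultimately show thesis using that IVT[of "\<lambda>s. s - half_angle s" \<phi> \<phi> "\<phi> + pi / 2"] by auto
qed

end

section \<open>The Poncelet map in a diagonalising frame\<close>

definition circle_point :: "real \<Rightarrow> real ^ 3" where
  "circle_point \<phi> = vector [cos \<phi>, sin \<phi>, 1]"

definition dehomog :: "real ^ 3 \<Rightarrow> real \<times> real" where
  "dehomog u = (u $ 1 / u $ 3, u $ 2 / u $ 3)"

lemma homog_nth [simp]: "homog p $ 1 = fst p" "homog p $ 2 = snd p" "homog p $ 3 = 1"
  by (simp_all add: homog_def)

lemma circle_point_nth [simp]:
  "circle_point \<phi> $ 1 = cos \<phi>" "circle_point \<phi> $ 2 = sin \<phi>" "circle_point \<phi> $ 3 = 1"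
  by (simp_all add: circle_point_def)

lemma dehomog_homog [simp]: "dehomog (homog p) = p"
  by (simp add: dehomog_def)

lemma homog_dehomog: "u $ 3 \<noteq> 0 \<Longrightarrow> homog (dehomog u) = (1 / u $ 3) *\<^sub>R u"
  by (simp add: vec_eq_iff forall_3 dehomog_def)

lemma dehomog_in_conic_iff:
  assumes "u $ 3 \<noteq> 0"
  shows "dehomog u \<in> conic_of D \<longleftrightarrow> u \<bullet> (D *v u) = 0"
  using assms by (simp add: conic_of_def homog_dehomog matrix_vector_mult_scaleR)

text \<open>Orientation in the affine plane is a determinant of homogeneous vectors, which makes its behaviour
under linear maps of the homogeneous coordinates multiplicative.\<close>
lemma orient2_dehomog:
  assumes "u $ 3 \<noteq> 0" "v $ 3 \<noteq> 0" "w $ 3 \<noteq> 0"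
  shows "orient2 (dehomog u) (dehomog v) (dehomog w)
    = det (vector [u, v, w] :: real ^ 3 ^ 3) / (u $ 3 * v $ 3 * w $ 3)"
  using assms by (simp add: orient2_def dehomog_def det_3 field_simps)

lemma det_vector_matrix_mult:
  fixes T :: "real ^ 3 ^ 3"
  shows "det (vector [T *v u, T *v v, T *v w] :: real ^ 3 ^ 3)
    = det T * det (vector [u, v, w] :: real ^ 3 ^ 3)"
proof -
  have "(vector [T *v u, T *v v, T *v w] :: real ^ 3 ^ 3) = vector [u, v, w] ** transpose T"
    by (simp add: vec_eq_iff forall_3 matrix_matrix_mult_def matrix_vector_mult_def
        transpose_def sum_3 mult.commute)
  then show ?thesis by (simp add: det_mul det_transpose)
qed

lemma dehomog_in_closed_segment:
  assumes "0 \<le> a" "0 \<le> b" "0 < a * u $ 3 + b * v $ 3" "0 < u $ 3" "0 < v $ 3"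
  shows "dehomog (a *\<^sub>R u + b *\<^sub>R v) \<in> closed_segment (dehomog u) (dehomog v)"
proof -
  define w where "w = a * u $ 3 + b * v $ 3"
  have w: "w > 0" using assms by (simp add: w_def)
  have "dehomog (a *\<^sub>R u + b *\<^sub>R v)
      = (a * u $ 3 / w) *\<^sub>R dehomog u + (b * v $ 3 / w) *\<^sub>R dehomog v"
    using assms w by (simp add: dehomog_def w_def[symmetric] add_divide_distrib)
  moreover have "a * u $ 3 / w = 1 - b * v $ 3 / w"
    using w by (simp add: field_simps) (simp add: w_def)
  moreover have "0 \<le> b * v $ 3 / w" "b * v $ 3 / w \<le> 1"
    using assms w by (auto simp: field_simps) (simp add: w_def)
  ultimately show ?thesis unfolding closed_segment_def by force
qed

lemma closed_segment_subset_tangent_line: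
  assumes "a \<in> tangent_line D p" "b \<in> tangent_line D p"
  shows "closed_segment a b \<subseteq> tangent_line D p"
proof
  fix q assume "q \<in> closed_segment a b"
  then obtain t where "q = (1 - t) *\<^sub>R a + t *\<^sub>R b" unfolding closed_segment_def by auto
  then have "homog q = (1 - t) *\<^sub>R homog a + t *\<^sub>R homog b"
    by (simp add: vec_eq_iff forall_3)
  then show "q \<in> tangent_line D p"
    using assms by (simp add: tangent_line_def inner_add_left)
qed

text \<open>Injectivity modulo 1 comes for free: if two distinct parameters within a period had the same image,
any parameter between them would give a degenerate triple.\<close>
lemma ccw_identificationI:
  assumes cont: "continuous_on UNIV h" and range: "range h = S"
    and per: "\<And>t n. h (t + of_int n) = h t"
    and ccw: "\<And>r s t. r < s \<Longrightarrow> s < t \<Longrightarrow> t < r + 1 \<Longrightarrow> orient2 (h r) (h s) (h t) > 0"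
  shows "ccw_identification S h"
proof -
  have "s - t \<in> \<int>" if "h s = h t" for s t
  proof -
    define n where "n = \<lfloor>t - s\<rfloor>"
    define t' where "t' = t + of_int (- n)"
    have t': "s \<le> t'" "t' < s + 1" unfolding t'_def n_def by linarith+
    have "h t' = h s" using that per[of t "- n"] unfolding t'_def by simp
    then have "orient2 (h s) (h ((s + t') / 2)) (h t') = 0" by (simp add: orient2_def)
    then have "\<not> s < t'" using ccw[of s "(s + t') / 2" t'] t' by fastforce
    then have "t' = s" using t' by linarith
    then have "s - t = of_int (- n)" by (simp add: t'_def)
    then show ?thesis by (metis Ints_of_int)
  qed
  moreover have "h s = h t" if "s - t \<in> \<int>" for s t
    using that per[of t] by (metis Ints_cases add.commute diff_add_cancel)
  ultimately show ?thesis unfolding ccw_identification_def using assms by blast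
qed

lemma orient2_segment_point:
  "orient2 a ((1 - t) *\<^sub>R a + t *\<^sub>R b) c = t * orient2 a b c"
  by (simp add: orient2_def algebra_simps)

lemma weighted_Cauchy_Schwarz:
  fixes a b x y c s :: real
  assumes "0 < a" "0 < b"
  shows "(x * c + y * s)\<^sup>2 \<le> (a * x\<^sup>2 + b * y\<^sup>2) * (c\<^sup>2 / a + s\<^sup>2 / b)"
proof -
  have "(a * x\<^sup>2 + b * y\<^sup>2) * (c\<^sup>2 / a + s\<^sup>2 / b) - (x * c + y * s)\<^sup>2
      = (a * x * s - b * y * c)\<^sup>2 / (a * b)"
    using assms by (simp add: field_simps power2_eq_square)
  also have "\<dots> \<ge> 0" using assms by simp
  finally show ?thesis by simp
qed

text \<open>Coordinates in which the conic becomes the unit circle. The last assumption says that the third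
coordinate of the affine chart keeps its sign on the closed unit disc, so that the projective map
\<open>dehomog \<circ> (*v) T\<close> is defined there and, as \<open>det T\<close> is positive, preserves
orientation and betweenness.\<close>
locale conic_frame =
  fixes C T :: "real ^ 3 ^ 3"
  assumes form: "\<And>u v. (T *v u) \<bullet> (C *v (T *v v)) = u $ 1 * v $ 1 + u $ 2 * v $ 2 - u $ 3 * v $ 3"
    and det_pos: "0 < det T"
    and third_pos: "\<And>u. (u $ 1)\<^sup>2 + (u $ 2)\<^sup>2 \<le> (u $ 3)\<^sup>2 \<Longrightarrow> 0 < u $ 3 \<Longrightarrow> 0 < (T *v u) $ 3"
begin

definition pt :: "real \<Rightarrow> real \<times> real" where
  "pt \<phi> = dehomog (T *v circle_point \<phi>)"

lemma circle_third_pos: "0 < (T *v circle_point \<phi>) $ 3"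
  by (rule third_pos) simp_all

text \<open>A vector of the cone \<open>x\<^sup>2 + y\<^sup>2 \<le> z\<^sup>2\<close> that represents a point of the plane belongs
to the upper half of the cone, since \<open>T\<close> maps the lower half to vectors with negative third
coordinate.\<close>
lemma homog_representation:
  obtains u where "homog p = T *v u" "(u $ 1)\<^sup>2 + (u $ 2)\<^sup>2 \<le> (u $ 3)\<^sup>2 \<Longrightarrow> 0 < u $ 3"
proof -
  have "invertible T" using det_pos by (simp add: invertible_det_nz)
  then obtain T' where "T ** T' = mat 1" by (auto simp: invertible_right_inverse)
  then have "T *v (T' *v homog p) = homog p" by (simp add: matrix_vector_mul_assoc)
  then obtain u where u: "homog p = T *v u" by metis
  have "0 < u $ 3" if le: "(u $ 1)\<^sup>2 + (u $ 2)\<^sup>2 \<le> (u $ 3)\<^sup>2"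
  proof (rule ccontr)
    assume "\<not> 0 < u $ 3"
    then consider "u $ 3 = 0" | "u $ 3 < 0" by linarith
    then show False
    proof cases
      case 1
      then have "u = 0" using le
        by (simp add: vec_eq_iff forall_3) (metis sum_power2_le_zero_iff)
      then have "homog p $ 3 = 0" using u by simp
      then show False by simp
    next
      case 2
      then have "0 < (T *v (- u)) $ 3" using le by (intro third_pos) auto
      then have "0 < - (homog p $ 3)" using u by (simp add: vec.neg)
      then show False by simp
    qed
  qed
  then show thesis using that u by blast
qed

lemma pt_periodic: "pt (\<phi> + 2 * pi * of_int n) = pt \<phi>"
proof -
  have "circle_point (\<phi> + 2 * pi * of_int n) = circle_point \<phi>"
    by (simp add: vec_eq_iff forall_3 cos_add sin_add sin_int_2pin cos_int_2pin)
  then show ?thesis by (simp add: pt_def)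
qed

lemma range_pt: "range pt = conic_of C"
proof (intro equalityI subsetI)
  fix p assume "p \<in> range pt"
  then show "p \<in> conic_of C"
    using circle_third_pos
    by (auto simp: pt_def dehomog_in_conic_iff less_imp_neq[symmetric] form
        simp flip: power2_eq_square)
next
  fix p assume p: "p \<in> conic_of C"
  obtain u where u: "homog p = T *v u" "(u $ 1)\<^sup>2 + (u $ 2)\<^sup>2 \<le> (u $ 3)\<^sup>2 \<Longrightarrow> 0 < u $ 3"
    using homog_representation by blast
  have eq: "(u $ 1)\<^sup>2 + (u $ 2)\<^sup>2 = (u $ 3)\<^sup>2"
    using p by (simp add: conic_of_def u form power2_eq_square)
  then have u3: "u $ 3 > 0" using u by simp
  then have "(u $ 1 / u $ 3)\<^sup>2 + (u $ 2 / u $ 3)\<^sup>2 = 1"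
    using eq by (simp add: power_divide flip: add_divide_distrib)
  then obtain \<phi> where \<phi>: "u $ 1 / u $ 3 = cos \<phi>" "u $ 2 / u $ 3 = sin \<phi>"
    using sincos_total_2pi by metis
  have "circle_point \<phi> = (1 / u $ 3) *\<^sub>R u"
    using u3 by (simp add: vec_eq_iff forall_3 flip: \<phi>)
  then have "T *v circle_point \<phi> = (1 / u $ 3) *\<^sub>R homog p"
    by (simp add: u matrix_vector_mult_scaleR)
  then have "pt \<phi> = p" using u3 by (simp add: pt_def dehomog_def)
  then show "p \<in> range pt" by blast
qed

lemma pt_in_period:
  assumes "p \<in> conic_of C"
  obtains \<psi> where "p = pt \<psi>" "\<phi> \<le> \<psi>" "\<psi> < \<phi> + 2 * pi"
proof -
  obtain \<theta> where \<theta>: "p = pt \<theta>" using assms range_pt by blast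
  define n where "n = \<lfloor>(\<theta> - \<phi>) / (2 * pi)\<rfloor>"
  have "of_int n \<le> (\<theta> - \<phi>) / (2 * pi)" "(\<theta> - \<phi>) / (2 * pi) < of_int n + 1"
    unfolding n_def by linarith+
  then have "2 * pi * of_int n \<le> \<theta> - \<phi>" "\<theta> - \<phi> < 2 * pi * of_int n + 2 * pi"
    by (simp_all add: field_simps)
  moreover have "p = pt (\<theta> + 2 * pi * of_int (- n))" using \<theta> pt_periodic by metis
  ultimately show thesis by (intro that[of "\<theta> + 2 * pi * of_int (- n)"]) auto
qed

lemma det_circle_points:
  "det (vector [circle_point (s - d), circle_point (s + d), u] :: real ^ 3 ^ 3)
    = 2 * sin d * (u $ 3 * cos d - u $ 1 * cos s - u $ 2 * sin s)"
proof -
  have "(sin s)\<^sup>2 + (cos s)\<^sup>2 = 1" "(sin d)\<^sup>2 + (cos d)\<^sup>2 = 1" by simp_all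
  then show ?thesis
    unfolding det_3 vector_3 circle_point_nth cos_add sin_add cos_diff sin_diff by algebra
qed

text \<open>The determinant of the points with angles \<open>m - d\<close>, \<open>m + d\<close>, \<open>t\<close> is
\<open>2 sin d (cos d - cos (t - m))\<close>, which is positive for \<open>t\<close> outside the arc.\<close>
lemma orient2_pt_pos:
  assumes "r < s" "s < t" "t < r + 2 * pi"
  shows "0 < orient2 (pt r) (pt s) (pt t)"
proof -
  define m d where "m = (r + s) / 2" and "d = (s - r) / 2"
  have r: "r = m - d" and s: "s = m + d" by (simp_all add: m_def d_def field_simps)
  have "cos m * cos t + sin m * sin t = cos (t - m)" by (simp add: cos_diff)
  moreover have "cos (t - m) < cos d"
  proof -
    have "0 \<le> d" using assms by (simp add: d_def)
    moreover have "d < t - m" using assms unfolding m_def d_def by argo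
    moreover have "d < 2 * pi - (t - m)" using assms unfolding m_def d_def by argo
    ultimately have md: "0 \<le> d \<and> d < t - m \<and> d < 2 * pi - (t - m)" by blast
    show ?thesis
    proof (cases "t - m \<le> pi")
      case True
      then show ?thesis using md by (intro cos_monotone_0_pi) auto
    next
      case False
      have "cos (2 * pi - (t - m)) < cos d"
        by (rule cos_monotone_0_pi) (use False md in auto)
      then show ?thesis by (simp add: cos_diff)
    qed
  qed
  moreover have "0 < sin d" by (rule sin_gt_zero) (use assms in \<open>auto simp: d_def\<close>)
  ultimately have "0 < det (vector [circle_point r, circle_point s, circle_point t] :: real ^ 3 ^ 3)"
    unfolding r s det_circle_points by (simp add: algebra_simps)
  then show ?thesis
    using circle_third_pos det_pos
    by (simp add: pt_def orient2_dehomog less_imp_neq[symmetric] det_vector_matrix_mult)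
qed

lemma continuous_on_pt: "continuous_on UNIV pt"
  unfolding pt_def dehomog_def
  using circle_third_pos
  by (auto simp: matrix_vector_mult_def sum_3 less_imp_neq[symmetric] intro!: continuous_intros)

text \<open>The chord \<open>x cos s + y sin s = cos d\<close> touches the ellipse at the point with homogeneous coordinates
\<open>(\<gamma>/\<alpha> cos s, \<gamma>/\<beta> sin s, cos d)\<close>, by the assumption \<open>tangent\<close>; the assumption
\<open>between\<close> places it inside the chord, and Cauchy-Schwarz places the ellipse on the left.
For uniqueness suppose that two tangent chords start at the same point, with points of tangency
\<open>p\<close> and \<open>p'\<close>. Each of \<open>p\<close>, \<open>p'\<close> is weakly to the left of the chord through the other
one, so both are on the same line through the starting point, and a line meets the outer conic in at
most one further point.\<close>
lemma poncelet_map_pt: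
  assumes D: "\<And>u v. (T *v u) \<bullet> (D *v (T *v v)) = \<alpha> * (u $ 1 * v $ 1) + \<beta> * (u $ 2 * v $ 2) - \<gamma> * (u $ 3 * v $ 3)"
    and \<gamma>: "0 < \<gamma>" "\<gamma> < \<alpha>" "\<gamma> < \<beta>"
    and d: "0 < d" "d < pi / 2"
    and tangent: "(cos d)\<^sup>2 = \<gamma> / \<alpha> * (cos s)\<^sup>2 + \<gamma> / \<beta> * (sin s)\<^sup>2"
    and between: "\<bar>(\<gamma> / \<beta> - \<gamma> / \<alpha>) * (sin s * cos s)\<bar> < sin d * cos d"
  shows "poncelet_map C D (pt (s - d)) = pt (s + d)"
proof -
  have sd: "0 < sin d" and cd: "0 < cos d"
    using d by (auto intro: sin_gt_zero cos_gt_zero)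
  define y0 y1 where "y0 = T *v circle_point (s - d)" and "y1 = T *v circle_point (s + d)"
  have y: "0 < y0 $ 3" "0 < y1 $ 3" by (simp_all add: y0_def y1_def circle_third_pos)
  define u where "u = (vector [\<gamma> / \<alpha> * cos s, \<gamma> / \<beta> * sin s, cos d] :: real ^ 3)"
  have u [simp]: "u $ 1 = \<gamma> / \<alpha> * cos s" "u $ 2 = \<gamma> / \<beta> * sin s" "u $ 3 = cos d"
    by (simp_all add: u_def)
  define g where "g = (\<gamma> / \<beta> - \<gamma> / \<alpha>) * (sin s * cos s) / sin d"
  have g: "\<bar>g\<bar> < cos d"
    using between sd by (simp add: g_def abs_divide pos_divide_less_eq mult.commute)
  \<comment> \<open>The barycentric weights, up to scale, of the point of tangency in the chord.\<close>
  define k0 k1 where "k0 = (cos d - g) / 2" and "k1 = (cos d + g) / 2"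
  have k: "0 < k0" "0 < k1" using g by (auto simp: k0_def k1_def)
  have gs: "g * sin d = (\<gamma> / \<beta> - \<gamma> / \<alpha>) * (sin s * cos s)" using sd by (simp add: g_def)
  have ucomb: "u = k0 *\<^sub>R circle_point (s - d) + k1 *\<^sub>R circle_point (s + d)"
  proof -
    have "k0 * cos (s - d) + k1 * cos (s + d) = cos s * (cos d)\<^sup>2 - sin s * (g * sin d)"
      by (simp add: k0_def k1_def cos_add cos_diff field_simps power2_eq_square)
    also have "\<dots> = \<gamma> / \<alpha> * cos s * ((cos s)\<^sup>2 + (sin s)\<^sup>2)"
      unfolding tangent gs
      by (simp add: algebra_simps power2_eq_square
          del: sin_cos_squared_add sin_cos_squared_add2 sin_cos_squared_add3)
    also have "\<dots> = \<gamma> / \<alpha> * cos s" by (simp only: sin_cos_squared_add2 mult_1_right)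
    finally have 1: "k0 * cos (s - d) + k1 * cos (s + d) = \<gamma> / \<alpha> * cos s" by simp
    have "k0 * sin (s - d) + k1 * sin (s + d) = sin s * (cos d)\<^sup>2 + cos s * (g * sin d)"
      by (simp add: k0_def k1_def sin_add sin_diff field_simps power2_eq_square)
    also have "\<dots> = \<gamma> / \<beta> * sin s * ((cos s)\<^sup>2 + (sin s)\<^sup>2)"
      unfolding tangent gs
      by (simp add: algebra_simps power2_eq_square
          del: sin_cos_squared_add sin_cos_squared_add2 sin_cos_squared_add3)
    also have "\<dots> = \<gamma> / \<beta> * sin s" by (simp only: sin_cos_squared_add2 mult_1_right)
    finally have 2: "k0 * sin (s - d) + k1 * sin (s + d) = \<gamma> / \<beta> * sin s" by simp
    have "k0 + k1 = cos d" by (simp add: k0_def k1_def field_simps)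
    then show ?thesis using 1 2 by (simp add: vec_eq_iff forall_3)
  qed
  define y where "y = T *v u"
  have ycomb: "y = k0 *\<^sub>R y0 + k1 *\<^sub>R y1"
    unfolding y_def ucomb y0_def y1_def
    by (simp add: matrix_vector_right_distrib matrix_vector_mult_scaleR)
  have y3: "0 < k0 * y0 $ 3 + k1 * y1 $ 3" using k y by (simp add: add_pos_pos)
  then have y3': "0 < y $ 3" by (simp add: ycomb)
  define p where "p = dehomog y"
  have pseg: "p \<in> closed_segment (pt (s - d)) (pt (s + d))"
    unfolding p_def ycomb pt_def y0_def[symmetric] y1_def[symmetric]
    using dehomog_in_closed_segment[of k0 k1 y0 y1] k y y3 by simp
  have pD: "p \<in> conic_of D"
  proof -
    have "y \<bullet> (D *v y) = \<gamma> * (\<gamma> / \<alpha> * (cos s)\<^sup>2 + \<gamma> / \<beta> * (sin s)\<^sup>2 - (cos d)\<^sup>2)"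
      unfolding y_def D using \<gamma> by (simp add: field_simps power2_eq_square)
    then have "y \<bullet> (D *v y) = 0" using tangent by simp
    then show ?thesis unfolding p_def using y3' by (simp add: dehomog_in_conic_iff)
  qed
  have endpoints: "pt \<phi> \<in> tangent_line D p" if "cos \<phi> * cos s + sin \<phi> * sin s = cos d" for \<phi>
  proof -
    have "(T *v circle_point \<phi>) \<bullet> (D *v y) = \<gamma> * (cos \<phi> * cos s + sin \<phi> * sin s - cos d)"
      unfolding y_def D using \<gamma> by (simp add: field_simps)
    then show ?thesis
      using circle_third_pos[of \<phi>] y3' that unfolding tangent_line_def p_def pt_def
      by (simp add: homog_dehomog matrix_vector_mult_scaleR)
  qed
  have "cos (s - d) * cos s + sin (s - d) * sin s = cos d"
    using cos_diff[of "s - d" s] by simp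
  moreover have "cos (s + d) * cos s + sin (s + d) * sin s = cos d"
    using cos_diff[of "s + d" s] by simp
  ultimately have lines: "closed_segment (pt (s - d)) (pt (s + d)) \<subseteq> tangent_line D p"
    by (intro closed_segment_subset_tangent_line endpoints)
  have ccw: "0 < orient2 (pt (s - d)) (pt s) (pt (s + d))"
    using d by (intro orient2_pt_pos) auto
  then have ne: "pt (s - d) \<noteq> pt (s + d)" by (auto simp: orient2_def)
  have left: "on_left (conic_of D) (pt (s - d)) (pt (s + d))"
    unfolding on_left_def
  proof
    fix q assume q: "q \<in> conic_of D"
    obtain v where v: "homog q = T *v v" "(v $ 1)\<^sup>2 + (v $ 2)\<^sup>2 \<le> (v $ 3)\<^sup>2 \<Longrightarrow> 0 < v $ 3"
      using homog_representation by blast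
    have eq: "\<alpha> * (v $ 1)\<^sup>2 + \<beta> * (v $ 2)\<^sup>2 = \<gamma> * (v $ 3)\<^sup>2"
      using q by (simp add: conic_of_def v D power2_eq_square)
    have "\<gamma> * ((v $ 1)\<^sup>2 + (v $ 2)\<^sup>2) \<le> \<gamma> * (v $ 3)\<^sup>2"
      unfolding eq[symmetric] distrib_left using \<gamma> by (intro add_mono mult_right_mono) auto
    then have v3: "0 < v $ 3" using v \<gamma> by simp
    have "(v $ 3 * cos d)\<^sup>2 = (\<alpha> * (v $ 1)\<^sup>2 + \<beta> * (v $ 2)\<^sup>2) * ((cos s)\<^sup>2 / \<alpha> + (sin s)\<^sup>2 / \<beta>)"
      unfolding eq power_mult_distrib tangent by (simp add: algebra_simps)
    then have "(v $ 1 * cos s + v $ 2 * sin s)\<^sup>2 \<le> (v $ 3 * cos d)\<^sup>2"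
      using weighted_Cauchy_Schwarz[of \<alpha> \<beta> "v $ 1" "cos s" "v $ 2" "sin s"] \<gamma> by linarith
    then have "v $ 1 * cos s + v $ 2 * sin s \<le> v $ 3 * cos d"
      by (rule power2_le_imp_le) (use v3 cd in simp)
    then have "0 \<le> det (vector [circle_point (s - d), circle_point (s + d), v] :: real ^ 3 ^ 3)"
      unfolding det_circle_points using sd by simp
    moreover have "q = dehomog (T *v v)" using dehomog_homog[of q] unfolding v(1) by (rule sym)
    moreover have "(T *v v) $ 3 = 1" using homog_nth(3)[of q] unfolding v(1) .
    ultimately show "0 \<le> orient2 (pt (s - d)) (pt (s + d)) q"
      using circle_third_pos det_pos
      by (simp add: pt_def orient2_dehomog less_imp_neq[symmetric] det_vector_matrix_mult less_imp_le)
  qed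
  \<comment> \<open>The starting point is off the ellipse, hence different from the points of tangency.\<close>
  have notD: "pt \<phi> \<notin> conic_of D" for \<phi>
  proof -
    have "\<alpha> * (cos \<phi>)\<^sup>2 + \<beta> * (sin \<phi>)\<^sup>2 - \<gamma> = (\<alpha> - \<gamma>) * (cos \<phi>)\<^sup>2 + (\<beta> - \<gamma>) * (sin \<phi>)\<^sup>2"
      by (simp add: sin_squared_eq algebra_simps)
    moreover have "\<dots> > 0"
    proof (cases "cos \<phi> = 0")
      case True
      then have "(sin \<phi>)\<^sup>2 = 1" by (simp add: sin_squared_eq)
      then show ?thesis using \<gamma> True by simp
    next
      case False
      then show ?thesis using \<gamma> by (intro add_pos_nonneg) auto
    qed
    ultimately show ?thesis
      using circle_third_pos[of \<phi>]
      by (simp add: pt_def dehomog_in_conic_iff less_imp_neq[symmetric] D flip: power2_eq_square)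
  qed
  show ?thesis
    unfolding poncelet_map_def
  proof (rule the_equality)
    show "pt (s + d) \<in> conic_of C \<and> segment_tangent D (pt (s - d)) (pt (s + d))
        \<and> on_left (conic_of D) (pt (s - d)) (pt (s + d))"
      using range_pt ne left pseg pD lines unfolding segment_tangent_def by blast
  next
    fix z assume z: "z \<in> conic_of C \<and> segment_tangent D (pt (s - d)) z \<and> on_left (conic_of D) (pt (s - d)) z"
    obtain \<psi> where \<psi>: "z = pt \<psi>" "s - d \<le> \<psi>" "\<psi> < s - d + 2 * pi"
      using z pt_in_period by blast
    obtain p' where p': "p' \<in> conic_of D" "p' \<in> closed_segment (pt (s - d)) z"
      and zne: "pt (s - d) \<noteq> z" using z unfolding segment_tangent_def by blast
    have \<psi>gt: "s - d < \<psi>" using \<psi> zne by (metis less_eq_real_def)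
    obtain t where t: "p = (1 - t) *\<^sub>R pt (s - d) + t *\<^sub>R pt (s + d)" "0 \<le> t"
      using pseg unfolding closed_segment_def by blast
    obtain t' where t': "p' = (1 - t') *\<^sub>R pt (s - d) + t' *\<^sub>R z" "0 \<le> t'"
      using p' unfolding closed_segment_def by blast
    have "t \<noteq> 0" "t' \<noteq> 0" using t t' notD pD p' by auto
    then have tpos: "0 < t" "0 < t'" using t t' by auto
    have "0 \<le> orient2 (pt (s - d)) (pt (s + d)) p'" using left p' unfolding on_left_def by blast
    then have "0 \<le> t' * orient2 (pt (s - d)) (pt (s + d)) z"
      unfolding t' by (subst (asm) orient2_swap) (simp add: orient2_segment_point orient2_swap[of _ z])
    moreover have "0 \<le> orient2 (pt (s - d)) z p" using z pD unfolding on_left_def by blast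
    then have "0 \<le> t * orient2 (pt (s - d)) z (pt (s + d))"
      unfolding t by (subst (asm) orient2_swap)
        (simp add: orient2_segment_point orient2_swap[of _ "pt (s + d)"])
    ultimately have zero: "orient2 (pt (s - d)) (pt (s + d)) z = 0"
      using tpos orient2_swap[of "pt (s - d)" "pt (s + d)" z]
      by (auto simp: zero_le_mult_iff mult_le_0_iff)
    show "z = pt (s + d)"
    proof (rule ccontr)
      assume "z \<noteq> pt (s + d)"
      then consider "\<psi> < s + d" | "s + d < \<psi>" using \<psi> by fastforce
      then show False
      proof cases
        case 1
        then have "0 < orient2 (pt (s - d)) z (pt (s + d))"
          unfolding \<psi> using \<psi>gt d by (intro orient2_pt_pos) auto
        then show False using zero orient2_swap[of "pt (s - d)" "pt (s + d)" z] by simp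
      next
        case 2
        then have "0 < orient2 (pt (s - d)) (pt (s + d)) z"
          unfolding \<psi> using \<psi> d by (intro orient2_pt_pos) auto
        then show False using zero by simp
      qed
    qed
  qed
qed

end

section \<open>Diagonalising the pencil\<close>

lemma symmetric_form_commute:
  fixes C :: "real ^ 'n ^ 'n"
  assumes "transpose C = C"
  shows "x \<bullet> (C *v y) = y \<bullet> (C *v x)"
  by (metis assms dot_lmul_matrix inner_commute transpose_matrix_vector)

lemma generalized_eigenvectors_orthogonal:
  fixes C D :: "real ^ 'n ^ 'n"
  assumes "transpose C = C" "transpose D = D" "D *v x = l *\<^sub>R (C *v x)" "D *v y = m *\<^sub>R (C *v y)" "l \<noteq> m"
  shows "x \<bullet> (C *v y) = 0"
proof -
  have "m * (x \<bullet> (C *v y)) = x \<bullet> (D *v y)" using assms(4) by simp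
  also have "\<dots> = y \<bullet> (D *v x)" using assms(2) by (rule symmetric_form_commute)
  also have "\<dots> = l * (x \<bullet> (C *v y))" using assms(3) symmetric_form_commute[OF assms(1), of x y] by simp
  finally show ?thesis using assms(5) by simp
qed

lemma generalized_eigenvector:
  fixes C D :: "real ^ 'n ^ 'n"
  assumes "invertible C" "l \<in> eigenvalues (matrix_inv C ** D)"
  obtains v where "v \<noteq> 0" "D *v v = l *\<^sub>R (C *v v)"
proof -
  obtain v where v: "v \<noteq> 0" "(matrix_inv C ** D) *v v = l *\<^sub>R v"
    using assms(2) by (auto simp: eigenvalues_def)
  have "C ** matrix_inv C = mat 1"
    using assms(1) unfolding invertible_def matrix_inv_def by (metis (mono_tags, lifting) someI_ex)
  then have "D *v v = C *v ((matrix_inv C ** D) *v v)"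
    by (simp add: matrix_vector_mul_assoc matrix_mul_assoc)
  then show thesis using that v by (simp add: matrix_vector_mult_scaleR)
qed

text \<open>On the line at infinity \<open>z = 0\<close> the form of an ellipse is positive definite. In particular the
form is positive somewhere on every plane through the origin.\<close>
lemma form_pos_at_infinity:
  assumes "positive_definite (upper_left_block C)" "u \<noteq> 0" "u $ 3 = 0"
  shows "0 < u \<bullet> (C *v u)"
proof -
  define v where "v = (vector [u $ 1, u $ 2] :: real ^ 2)"
  have "v \<noteq> 0" using assms(2,3) by (auto simp: v_def vec_eq_iff forall_2 forall_3)
  then have "0 < v \<bullet> (upper_left_block C *v v)" using assms(1) by (simp add: positive_definite_def)
  also have "\<dots> = u \<bullet> (C *v u)"
    using assms(3) by (simp add: v_def upper_left_block_def inner_vec_def matrix_vector_mult_def sum_2 sum_3)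
  finally show ?thesis .
qed

lemma det_vector_scaleR:
  fixes a b c :: "real ^ 3"
  shows "det (vector [r *\<^sub>R a, b, c] :: real ^ 3 ^ 3) = r * det (vector [a, b, c] :: real ^ 3 ^ 3)"
  by (simp add: det_3 algebra_simps)

lemma congruence_nth:
  fixes C V :: "real ^ 3 ^ 3"
  shows "(V ** (C ** transpose V)) $ i $ j = V $ i \<bullet> (C *v V $ j)"
  by (simp add: matrix_matrix_mult_def matrix_vector_mult_def inner_vec_def transpose_def)

lemma det_form_orthogonal:
  fixes C :: "real ^ 3 ^ 3"
  assumes "transpose C = C" "a \<bullet> (C *v b) = 0" "a \<bullet> (C *v c) = 0" "b \<bullet> (C *v c) = 0"
  shows "(det (vector [a, b, c] :: real ^ 3 ^ 3))\<^sup>2 * det C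
    = (a \<bullet> (C *v a)) * (b \<bullet> (C *v b)) * (c \<bullet> (C *v c))"
proof -
  define V where "V = (vector [a, b, c] :: real ^ 3 ^ 3)"
  have "(det V)\<^sup>2 * det C = det (V ** (C ** transpose V))"
    by (simp add: det_mul det_transpose power2_eq_square)
  also have "\<dots> = (a \<bullet> (C *v a)) * (b \<bullet> (C *v b)) * (c \<bullet> (C *v c))"
    unfolding det_3 congruence_nth using assms(2-) symmetric_form_commute[OF assms(1)]
    by (simp add: V_def symmetric_form_commute[OF assms(1), of b a]
        symmetric_form_commute[OF assms(1), of c a] symmetric_form_commute[OF assms(1), of c b])
  finally show ?thesis unfolding V_def .
qed

lemma columns_mult:
  "transpose (vector [a, b, c] :: real ^ 3 ^ 3) *v u = u $ 1 *\<^sub>R a + u $ 2 *\<^sub>R b + u $ 3 *\<^sub>R c"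
  by (simp add: vec_eq_iff forall_3 matrix_vector_mult_def transpose_def sum_3 mult.commute)

lemma form_columns:
  fixes C D :: "real ^ 3 ^ 3"
  assumes sym: "transpose C = C"
    and orth: "a \<bullet> (C *v b) = 0" "a \<bullet> (C *v c) = 0" "b \<bullet> (C *v c) = 0"
    and ev: "D *v a = l *\<^sub>R (C *v a)" "D *v b = m *\<^sub>R (C *v b)" "D *v c = n *\<^sub>R (C *v c)"
  defines "T \<equiv> transpose (vector [a, b, c] :: real ^ 3 ^ 3)"
  shows "(T *v u) \<bullet> (D *v (T *v v)) = l * (a \<bullet> (C *v a)) * (u $ 1 * v $ 1)
    + m * (b \<bullet> (C *v b)) * (u $ 2 * v $ 2) + n * (c \<bullet> (C *v c)) * (u $ 3 * v $ 3)"
proof -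
  have orth': "b \<bullet> (C *v a) = 0" "c \<bullet> (C *v a) = 0" "c \<bullet> (C *v b) = 0"
    using orth symmetric_form_commute[OF sym] by metis+
  show ?thesis
    unfolding T_def columns_mult
    by (simp add: matrix_vector_right_distrib matrix_vector_mult_scaleR inner_add_left
        inner_add_right ev orth orth')
qed

text \<open>Generalised eigenvectors \<open>v1\<close>, \<open>v2\<close>, \<open>v3\<close> for the distinct eigenvalues are orthogonal
with respect to \<open>C1\<close>, and none of them is isotropic: an isotropic one would lie on the cone of
\<open>C2\<close>, where \<open>C1\<close> is negative. At most one of the values \<open>q vi\<close> is negative, because
\<open>C1\<close> is positive at infinity, and at least one is because \<open>det C1 < 0\<close>. Since \<open>C2\<close>
is inside \<open>C1\<close>, the negative direction belongs to the smallest eigenvalue. It remains to normalise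
the vectors and to choose their signs, for the third coordinate and for the orientation.\<close>
lemma simultaneous_diagonalization:
  fixes C1 C2 :: "real ^ 3 ^ 3"
  assumes sym: "transpose C1 = C1" "transpose C2 = C2"
    and pos: "positive_definite (upper_left_block C1)" and det: "det C1 < 0"
    and eig: "eigenvalues (matrix_inv C1 ** C2) = {lam1, lam2, lam3}"
    and ord: "lam1 > lam2" "lam2 > lam3" "lam3 > 0"
    and inside: "\<And>u :: real ^ 3. u \<noteq> 0 \<Longrightarrow> u \<bullet> (C2 *v u) = 0 \<Longrightarrow> u \<bullet> (C1 *v u) < 0"
  obtains T where "conic_frame C1 T"
    and "\<And>u v. (T *v u) \<bullet> (C2 *v (T *v v))
      = lam1 * (u $ 1 * v $ 1) + lam2 * (u $ 2 * v $ 2) - lam3 * (u $ 3 * v $ 3)"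
proof -
  have inv: "invertible C1" using det by (simp add: invertible_det_nz)
  obtain v1 where v1: "v1 \<noteq> 0" "C2 *v v1 = lam1 *\<^sub>R (C1 *v v1)"
    using generalized_eigenvector[OF inv, of lam1 C2] eig by auto
  obtain v2 where v2: "v2 \<noteq> 0" "C2 *v v2 = lam2 *\<^sub>R (C1 *v v2)"
    using generalized_eigenvector[OF inv, of lam2 C2] eig by auto
  obtain v3 where v3: "v3 \<noteq> 0" "C2 *v v3 = lam3 *\<^sub>R (C1 *v v3)"
    using generalized_eigenvector[OF inv, of lam3 C2] eig by auto
  have orth: "v1 \<bullet> (C1 *v v2) = 0" "v1 \<bullet> (C1 *v v3) = 0" "v2 \<bullet> (C1 *v v3) = 0"
    using generalized_eigenvectors_orthogonal[OF sym] v1 v2 v3 ord by (metis less_irrefl less_trans)+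
  define q where "q v = v \<bullet> (C1 *v v)" for v
  have nz: "q v \<noteq> 0" if "v \<noteq> 0" "C2 *v v = l *\<^sub>R (C1 *v v)" for v l
    using inside[of v] that by (auto simp: q_def)
  have neg_smaller: "m < l"
    if "C2 *v x = l *\<^sub>R (C1 *v x)" "C2 *v y = m *\<^sub>R (C1 *v y)" "x \<bullet> (C1 *v y) = 0"
      "0 < l" "0 < m" "0 < q x" "q y < 0" for x y l m
  proof -
    \<comment> \<open>The weights make \<open>u\<close> isotropic for \<open>C2\<close>, while \<open>C1\<close> takes the value \<open>1/l - 1/m\<close> at \<open>u\<close>.\<close>
    define s t where "s = 1 / sqrt (l * q x)" and "t = 1 / sqrt (m * (- q y))"
    define u where "u = s *\<^sub>R x + t *\<^sub>R y"
    have st: "s\<^sup>2 = 1 / (l * q x)" "t\<^sup>2 = 1 / (m * (- q y))" "s \<noteq> 0"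
      using that mult_pos_pos[of l "q x"] mult_pos_pos[of m "- q y"]
      by (auto simp: s_def t_def power_divide)
    have yx: "y \<bullet> (C1 *v x) = 0" using that(3) symmetric_form_commute[OF sym(1)] by metis
    have "x \<bullet> (C1 *v u) = s * q x"
      using that by (simp add: u_def q_def matrix_vector_right_distrib matrix_vector_mult_scaleR inner_add_right)
    then have u0: "u \<noteq> 0" using st that by auto
    have C1u: "u \<bullet> (C1 *v u) = s\<^sup>2 * q x + t\<^sup>2 * q y"
      using that(3) yx by (simp add: u_def q_def matrix_vector_right_distrib matrix_vector_mult_scaleR
          inner_add_right inner_add_left power2_eq_square)
    have "u \<bullet> (C2 *v u) = l * (s\<^sup>2 * q x) + m * (t\<^sup>2 * q y)"
      using that(3) yx by (simp add: u_def q_def matrix_vector_right_distrib matrix_vector_mult_scaleR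
          inner_add_right inner_add_left power2_eq_square that(1,2))
    also have "\<dots> = 0" using that by (simp add: st)
    finally have "s\<^sup>2 * q x + t\<^sup>2 * q y < 0" using inside[OF u0] C1u by simp
    then have "1 / l - 1 / m < 0" using that by (simp add: st)
    then show "m < l" using that by (simp add: field_simps)
  qed
  have not_two_neg: False if "x \<bullet> (C1 *v y) = 0" "q x < 0" "q y < 0" for x y
  proof -
    have yx: "y \<bullet> (C1 *v x) = 0" using that(1) symmetric_form_commute[OF sym(1)] by metis
    \<comment> \<open>The plane spanned by \<open>x\<close> and \<open>y\<close> meets the plane at infinity.\<close>
    obtain s t where st: "s * x $ 3 + t * y $ 3 = 0" "s \<noteq> 0 \<or> t \<noteq> 0"
    proof (cases "y $ 3 = 0")
      case True
      then show thesis using that[of 0 1] by simp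
    next
      case False
      then show thesis using that[of "y $ 3" "- x $ 3"] by simp
    qed
    define u where "u = s *\<^sub>R x + t *\<^sub>R y"
    have eq: "u \<bullet> (C1 *v u) = s\<^sup>2 * q x + t\<^sup>2 * q y"
      using that(1) yx by (simp add: u_def q_def matrix_vector_right_distrib matrix_vector_mult_scaleR
          inner_add_right inner_add_left power2_eq_square)
    have "s\<^sup>2 * q x \<le> 0" "t\<^sup>2 * q y \<le> 0" using that by (simp_all add: mult_nonneg_nonpos)
    moreover have "s\<^sup>2 * q x \<noteq> 0 \<or> t\<^sup>2 * q y \<noteq> 0" using st that by auto
    ultimately have neg: "u \<bullet> (C1 *v u) < 0" unfolding eq by linarith
    then have "u \<noteq> 0" by auto
    then show False using form_pos_at_infinity[OF pos, of u] neg st by (simp add: u_def)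
  qed
  have q3: "q v3 < 0"
  proof (rule ccontr)
    assume "\<not> q v3 < 0"
    then have 3: "0 < q v3" using nz[OF v3] by simp
    have 1: "0 < q v1" using neg_smaller[OF v3(2) v1(2)] 3 ord nz[OF v1] orth symmetric_form_commute[OF sym(1), of v3 v1] by fastforce
    have 2: "0 < q v2" using neg_smaller[OF v3(2) v2(2)] 3 ord nz[OF v2] orth symmetric_form_commute[OF sym(1), of v3 v2] by fastforce
    have "0 < q v1 * q v2 * q v3" using 1 2 3 by simp
    moreover have "(det (vector [v1, v2, v3] :: real ^ 3 ^ 3))\<^sup>2 * det C1 \<le> 0"
      using det by (simp add: mult_nonneg_nonpos)
    ultimately show False using det_form_orthogonal[OF sym(1) orth] by (simp add: q_def)
  qed
  have q1: "0 < q v1" using not_two_neg[OF orth(2)] q3 nz[OF v1] by fastforce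
  have q2: "0 < q v2" using not_two_neg[OF orth(3)] q3 nz[OF v2] by fastforce
  have "v3 $ 3 \<noteq> 0" using form_pos_at_infinity[OF pos v3(1)] q3 by (auto simp: q_def)
  define c where "c = (sgn (v3 $ 3) / sqrt (- q v3)) *\<^sub>R v3"
  define b where "b = (1 / sqrt (q v2)) *\<^sub>R v2"
  define k where "k = det (vector [v1, b, c] :: real ^ 3 ^ 3)"
  define a where "a = (sgn k / sqrt (q v1)) *\<^sub>R v1"
  have sgn2: "sgn x * sgn x = 1" if "x \<noteq> 0" for x :: real using that by (simp add: sgn_if)
  have orth1: "v1 \<bullet> (C1 *v b) = 0" "v1 \<bullet> (C1 *v c) = 0" "b \<bullet> (C1 *v c) = 0"
    using orth by (simp_all add: b_def c_def matrix_vector_mult_scaleR)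
  have bb: "b \<bullet> (C1 *v b) = 1" using q2 by (simp add: b_def matrix_vector_mult_scaleR q_def[symmetric])
  have "c \<bullet> (C1 *v c) = (sgn (v3 $ 3) * sgn (v3 $ 3)) * q v3 / (sqrt (- q v3) * sqrt (- q v3))"
    by (simp add: c_def matrix_vector_mult_scaleR q_def)
  then have cc: "c \<bullet> (C1 *v c) = - 1" using q3 sgn2[OF \<open>v3 $ 3 \<noteq> 0\<close>] by simp
  have c3: "0 < c $ 3" using q3 \<open>v3 $ 3 \<noteq> 0\<close> by (simp add: c_def sgn_if)
  have k0: "k \<noteq> 0"
  proof
    assume "k = 0"
    then show False using det_form_orthogonal[OF sym(1) orth1] bb cc q1 by (simp add: k_def q_def)
  qed
  have "a \<bullet> (C1 *v a) = (sgn k * sgn k) * q v1 / (sqrt (q v1) * sqrt (q v1))"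
    by (simp add: a_def matrix_vector_mult_scaleR q_def)
  then have aa: "a \<bullet> (C1 *v a) = 1" using q1 sgn2[OF k0] by simp
  have orth2: "a \<bullet> (C1 *v b) = 0" "a \<bullet> (C1 *v c) = 0" "b \<bullet> (C1 *v c) = 0"
    using orth1 by (simp_all add: a_def)
  have ev: "C2 *v a = lam1 *\<^sub>R (C1 *v a)" "C2 *v b = lam2 *\<^sub>R (C1 *v b)" "C2 *v c = lam3 *\<^sub>R (C1 *v c)"
    using v1 v2 v3 by (simp_all add: a_def b_def c_def matrix_vector_mult_scaleR)
  define T where "T = transpose (vector [a, b, c] :: real ^ 3 ^ 3)"
  have C2T: "(T *v u) \<bullet> (C2 *v (T *v v))
      = lam1 * (u $ 1 * v $ 1) + lam2 * (u $ 2 * v $ 2) - lam3 * (u $ 3 * v $ 3)" for u v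
    using form_columns[OF sym(1) orth2 ev] by (simp add: T_def aa bb cc)
  have C1T: "(T *v u) \<bullet> (C1 *v (T *v v)) = u $ 1 * v $ 1 + u $ 2 * v $ 2 - u $ 3 * v $ 3" for u v
    using form_columns[OF sym(1) orth2, of C1 1 1 1] by (simp add: T_def aa bb cc)
  have "conic_frame C1 T"
  proof
    show "(T *v u) \<bullet> (C1 *v (T *v v)) = u $ 1 * v $ 1 + u $ 2 * v $ 2 - u $ 3 * v $ 3" for u v
      by (rule C1T)
    have "det T = sgn k / sqrt (q v1) * k"
      by (simp add: T_def det_transpose k_def a_def det_vector_scaleR)
    then show "0 < det T" using k0 q1 by (simp add: sgn_if)
    fix u :: "real ^ 3" assume u: "(u $ 1)\<^sup>2 + (u $ 2)\<^sup>2 \<le> (u $ 3)\<^sup>2" "0 < u $ 3"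
    define g where "g = u $ 1 * a $ 3 + u $ 2 * b $ 3"
    have T3: "(T *v u) $ 3 = g + u $ 3 * c $ 3" unfolding T_def columns_mult g_def by simp
    show "0 < (T *v u) $ 3"
    proof (rule ccontr)
      assume "\<not> 0 < (T *v u) $ 3"
      then have le: "u $ 3 * c $ 3 \<le> - g" using T3 by simp
      have pos3: "0 < u $ 3 * c $ 3" using u c3 by simp
      \<comment> \<open>Otherwise the third coordinate would vanish at a point \<open>w\<close> of the cone on the way from the axis to \<open>u\<close>, where \<open>C1\<close> is not positive.\<close>
      define r where "r = u $ 3 * c $ 3 / - g"
      have g: "g < 0" using le pos3 by linarith
      have r: "0 < r" "r \<le> 1" using g le pos3 by (auto simp: r_def field_simps)
      define w where "w = (vector [r * u $ 1, r * u $ 2, u $ 3] :: real ^ 3)"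
      have "(T *v w) $ 3 = r * g + u $ 3 * c $ 3"
        unfolding T_def columns_mult g_def by (simp add: w_def algebra_simps)
      also have "\<dots> = 0" using g by (simp add: r_def)
      finally have w3: "(T *v w) $ 3 = 0" .
      have "r\<^sup>2 * ((u $ 1)\<^sup>2 + (u $ 2)\<^sup>2) \<le> 1 * (u $ 3)\<^sup>2"
        using r u by (intro mult_mono) (auto simp: power_le_one)
      then have le0: "(T *v w) \<bullet> (C1 *v (T *v w)) \<le> 0"
        by (simp add: C1T w_def algebra_simps power2_eq_square)
      then have "T *v w = 0" using form_pos_at_infinity[OF pos _ w3] by fastforce
      moreover have "invertible T" using \<open>0 < det T\<close> by (simp add: invertible_det_nz)
      then obtain T' where "T' ** T = mat 1" by (auto simp: invertible_left_inverse)
      then have "T' *v (T *v w) = w" by (simp add: matrix_vector_mul_assoc)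
      ultimately have "w = 0" by simp
      then have "w $ 3 = 0" by simp
      then show False using u by (simp add: w_def)
    qed
  qed
  then show thesis using that C2T by blast
qed

text \<open>The parametrisation proportional to the invariant measure; one turn of the angle corresponds to an
increase of the elliptic integral by \<open>4 K\<close>.\<close>
lemma (in conic_frame) ccw_identification_am:
  assumes e: "e\<^sup>2 < 1"
  shows "ccw_identification (conic_of C) (\<lambda>t. pt (am (4 * ellK e * t) e))"
proof (rule ccw_identificationI)
  have K: "0 < ellK e" using e by (rule ellK_pos)
  show "continuous_on UNIV (\<lambda>t. pt (am (4 * ellK e * t) e))"
    by (rule continuous_on_compose2[OF continuous_on_pt])
       (auto intro!: continuous_on_compose2[OF continuous_on_am[OF e]] continuous_intros)
  have "\<exists>t. am (4 * ellK e * t) e = \<phi>" for \<phi>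
    by (rule exI[of _ "ellF \<phi> e / (4 * ellK e)"]) (use K am_ellF[OF e] in simp)
  then have "range (\<lambda>t. am (4 * ellK e * t) e) = UNIV" by (metis surj_def)
  then have "pt ` range (\<lambda>t. am (4 * ellK e * t) e) = conic_of C" by (simp add: range_pt)
  then show "range (\<lambda>t. pt (am (4 * ellK e * t) e)) = conic_of C" by (simp add: image_image)
  have add: "am (4 * ellK e * (t + of_int n)) e = am (4 * ellK e * t) e + 2 * pi * of_int n" for t n
    using am_add[OF e, of "4 * ellK e * t" n] by (simp add: algebra_simps)
  then show "pt (am (4 * ellK e * (t + of_int n)) e) = pt (am (4 * ellK e * t) e)" for t n
    by (simp add: pt_periodic)
  fix r s t :: real assume "r < s" "s < t" "t < r + 1"
  then have "am (4 * ellK e * t) e < am (4 * ellK e * (r + 1)) e"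
    using K by (simp add: am_less_iff[OF e])
  also have "\<dots> = am (4 * ellK e * r) e + 2 * pi" using add[of r 1] by simp
  finally have "am (4 * ellK e * t) e < am (4 * ellK e * r) e + 2 * pi" .
  then show "0 < orient2 (pt (am (4 * ellK e * r) e)) (pt (am (4 * ellK e * s) e)) (pt (am (4 * ellK e * t) e))"
    using K \<open>r < s\<close> \<open>s < t\<close> by (intro orient2_pt_pos) (auto simp: am_less_iff[OF e])
qed

text \<open>In the invariant parameter a tangent chord always advances by the same amount, which is read off from
the chord that is perpendicular to the first axis: it joins the angles \<open>-d\<close> and \<open>d\<close>, and
\<open>F d - F (-d) = 2 F d\<close>.\<close>
lemma (in conic_frame) rotation_number_poncelet_map:
  assumes D: "\<And>u v. (T *v u) \<bullet> (D *v (T *v v)) = \<alpha> * (u $ 1 * v $ 1) + \<beta> * (u $ 2 * v $ 2) - \<gamma> * (u $ 3 * v $ 3)"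
    and \<gamma>: "0 < \<gamma>" "\<gamma> < \<beta>" "\<beta> < \<alpha>" and e: "e\<^sup>2 = (\<alpha> - \<beta>) / (\<alpha> - \<gamma>)"
  obtains d where "0 < d" "d < pi / 2" "(cos d)\<^sup>2 = \<gamma> / \<alpha>"
    "rotation_number (conic_of C) (poncelet_map C D) = ellF d e / (2 * ellK e)"
proof -
  interpret H: half_chord "\<gamma> / \<alpha>" "\<gamma> / \<beta>" e
  proof
    show "0 < \<gamma> / \<alpha>" "\<gamma> / \<alpha> < \<gamma> / \<beta>" "\<gamma> / \<beta> < 1"
      using \<gamma> by (simp_all add: divide_strict_left_mono)
    show "e\<^sup>2 * (\<gamma> / \<beta> * (1 - \<gamma> / \<alpha>)) = \<gamma> / \<beta> - \<gamma> / \<alpha>"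
      unfolding e using \<gamma> by (simp add: field_simps)
  qed
  define K where "K = ellK e"
  have K: "0 < K" unfolding K_def using H.modulus by (rule ellK_pos)
  define d where "d = H.half_angle 0"
  have d: "0 < d" "d < pi / 2" "(cos d)\<^sup>2 = \<gamma> / \<alpha>"
    using H.half_angle_pos[of 0] H.half_angle_less[of 0] H.cos_half_angle[of 0] by (auto simp: d_def)
  have F: "0 < ellF d e" "ellF d e < K"
    using strict_monoD[OF ellF_strict_mono[OF H.modulus]] d ellF_0 by (force simp: K_def ellK_def)+
  define \<rho> where "\<rho> = ellF d e / (2 * K)"
  have \<rho>: "0 \<le> \<rho>" "\<rho> < 1" using F K by (auto simp: \<rho>_def)
  have "poncelet_map C D (pt (am (4 * K * t) e)) = pt (am (4 * K * (t + \<rho>)) e)" for t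
  proof -
    obtain s where s: "am (4 * K * t) e = s - H.half_angle s" using H.half_angle_start by blast
    have "ellF (s + H.half_angle s) e = ellF (am (4 * K * t) e) e + 2 * ellF d e"
      unfolding s d_def by (rule H.ellF_chord_constant)
    also have "\<dots> = 4 * K * (t + \<rho>)"
      using K by (simp add: ellF_am[OF H.modulus] \<rho>_def field_simps)
    finally have "am (4 * K * (t + \<rho>)) e = s + H.half_angle s" using am_ellF[OF H.modulus] by metis
    moreover have "poncelet_map C D (pt (s - H.half_angle s)) = pt (s + H.half_angle s)"
      using \<gamma> by (intro poncelet_map_pt[OF D] H.half_angle_pos H.half_angle_less
          H.cos_half_angle H.half_angle_between) auto
    ultimately show ?thesis by (simp add: s)
  qed
  then have "rotation_number (conic_of C) (poncelet_map C D) = \<rho>"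
    using ccw_identification_am[OF H.modulus] \<rho> unfolding K_def
    by (intro rotation_number_eq_if_conjugate_to_translation)
  then show thesis using that d by (simp add: \<rho>_def K_def)
qed

theorem theorem4:
  fixes C1 C2 :: "real ^ 3 ^ 3" and lam1 lam2 lam3 e \<l> \<nu>1 \<nu>2 :: real
  assumes sym: "transpose C1 = C1" "transpose C2 = C2"
    and pos1: "positive_definite (upper_left_block C1)" and det1: "det C1 < 0"
    and pos2: "positive_definite (upper_left_block C2)" and det2: "det C2 < 0"
    and eig: "eigenvalues (matrix_inv C1 ** C2) = {lam1, lam2, lam3}"
    and ord: "lam1 > lam2" "lam2 > lam3" "lam3 > 0"
    and inside: "\<And>u :: real ^ 3. u \<noteq> 0 \<Longrightarrow> u \<bullet> (C2 *v u) = 0 \<Longrightarrow> u \<bullet> (C1 *v u) < 0"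
    and e: "e = sqrt ((lam1 - lam2) / (lam1 - lam3))"
    and l: "0 < \<l>" "\<l> < 1 / 2"
    and cone: "\<nu>2 > 0" "\<nu>1 + lam3 * \<nu>2 > 0"
  shows "rotation_number (conic_of C1) (poncelet_map C1 (\<nu>1 *\<^sub>R C1 + \<nu>2 *\<^sub>R C2)) = \<l> \<longleftrightarrow>
     \<nu>1 / \<nu>2 = (lam1 * (cn (2 * ellK e * \<l>) e)\<^sup>2 - lam3) / (sn (2 * ellK e * \<l>) e)\<^sup>2"
proof -
  obtain T where T: "conic_frame C1 T" and C2: "\<And>u v. (T *v u) \<bullet> (C2 *v (T *v v))
      = lam1 * (u $ 1 * v $ 1) + lam2 * (u $ 2 * v $ 2) - lam3 * (u $ 3 * v $ 3)"
    using simultaneous_diagonalization[OF sym pos1 det1 eig ord inside] by blast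
  interpret conic_frame C1 T by (rule T)
  define \<alpha> \<beta> \<gamma> where "\<alpha> = \<nu>1 + lam1 * \<nu>2" and "\<beta> = \<nu>1 + lam2 * \<nu>2" and "\<gamma> = \<nu>1 + lam3 * \<nu>2"
  have ordered: "0 < \<gamma>" "\<gamma> < \<beta>" "\<beta> < \<alpha>" using cone ord by (simp_all add: \<alpha>_def \<beta>_def \<gamma>_def)
  have e2: "e\<^sup>2 = (lam1 - lam2) / (lam1 - lam3)" using ord by (simp add: e)
  have modulus: "e\<^sup>2 < 1" using ord by (simp add: e2)
  have e\<nu>: "e\<^sup>2 = (\<alpha> - \<beta>) / (\<alpha> - \<gamma>)"
  proof -
    have "\<alpha> - \<beta> = (lam1 - lam2) * \<nu>2" "\<alpha> - \<gamma> = (lam1 - lam3) * \<nu>2"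
      by (simp_all add: \<alpha>_def \<beta>_def \<gamma>_def algebra_simps)
    then show ?thesis using cone by (simp add: e2)
  qed
  have "(T *v u) \<bullet> ((\<nu>1 *\<^sub>R C1 + \<nu>2 *\<^sub>R C2) *v (T *v v))
      = \<alpha> * (u $ 1 * v $ 1) + \<beta> * (u $ 2 * v $ 2) - \<gamma> * (u $ 3 * v $ 3)" for u v
    by (simp add: matrix_vector_mult_add_rdistrib scaleR_matrix_vector_assoc[symmetric]
        inner_add_right form C2 \<alpha>_def \<beta>_def \<gamma>_def algebra_simps)
  then obtain d where d: "0 < d" "d < pi / 2" "(cos d)\<^sup>2 = \<gamma> / \<alpha>"
    and rot: "rotation_number (conic_of C1) (poncelet_map C1 (\<nu>1 *\<^sub>R C1 + \<nu>2 *\<^sub>R C2)) = ellF d e / (2 * ellK e)"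
    using rotation_number_poncelet_map[OF _ ordered e\<nu>] by metis
  have K: "0 < ellK e" using modulus by (rule ellK_pos)
  define m where "m = am (2 * ellK e * \<l>) e"
  have Fm: "ellF m e = 2 * ellK e * \<l>" by (simp add: m_def ellF_am[OF modulus])
  have "ellF 0 e < ellF m e" "ellF m e < ellF (pi / 2) e"
    using K l by (simp_all add: Fm ellF_0 flip: ellK_def)
  then have m: "0 < m" "m < pi / 2" using strict_mono_less[OF ellF_strict_mono[OF modulus]] by auto
  have "ellF d e / (2 * ellK e) = \<l> \<longleftrightarrow> ellF d e = ellF m e" using K by (auto simp: Fm field_simps)
  also have "\<dots> \<longleftrightarrow> d = m" using strict_mono_eq[OF ellF_strict_mono[OF modulus]] .
  also have "\<dots> \<longleftrightarrow> cos d = cos m" using cos_inj_pi[of d m] d m by auto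
  also have "\<dots> \<longleftrightarrow> (cos d)\<^sup>2 = (cos m)\<^sup>2"
    using cos_gt_zero[of d] cos_gt_zero[of m] d(1,2) m by (subst power2_eq_iff_nonneg) auto
  also have "\<dots> \<longleftrightarrow> \<gamma> = \<alpha> * (cos m)\<^sup>2" using ordered by (auto simp: d field_simps)
  also have "\<dots> \<longleftrightarrow> \<nu>1 * (sin m)\<^sup>2 = \<nu>2 * (lam1 * (cos m)\<^sup>2 - lam3)"
    by (auto simp: \<alpha>_def \<gamma>_def sin_squared_eq algebra_simps)
  also have "\<dots> \<longleftrightarrow> \<nu>1 / \<nu>2 = (lam1 * (cos m)\<^sup>2 - lam3) / (sin m)\<^sup>2"
    using cone sin_gt_zero[of m] m by (auto simp: frac_eq_eq mult.commute)
  finally show ?thesis by (simp add: rot sn_def cn_def m_def)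
qed

end
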